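(* Let $n\ge 3$ and consider a hyperbolic $n$-gon in the Poincaré disc model whose vertices lie in the open unit disc, consecutive vertices being distinct. Suppose it has $l$ inward sides and $m$ outward sides (so $l+m=n$). Then the hyperbolic area $A$ of the $n$-gon is $$A=\sum_{k=1}^{l}\alpha_k-\sum_{k=1}^{m}\beta_k,$$ where $\alpha_1,\ldots,\alpha_l$ are the (Euclidean) angle measures of the circular arcs that are the inward sides, and $\beta_1,\ldots,\beta_m$ are the (Euclidean) angle measures of the circular arcs that are the outward sides.
   Context: The Poincaré disc model is the unit disc with the conformal metric $\frac{2}{1-|z|^2}|dz|$. The hyperbolic area of a region $\mathcal{R}$ in the disc is $\iint_{\mathcal{R}}\left(\frac{2}{1-x^2-y^2}\right)^2 dx\,dy$. The geodesic joining two distinct points is an arc, inside the disc, of a circle meeting the unit circle at right angles, or a Euclidean segment of a diameter. A hyperbolic $n$-gon with vertices $z_1,\ldots,z_n$ is the region bounded by the closed curve consisting of the geodesics from $z_k$ to $z_{k+1}$ (with $z_{n+1}=z_1$), where this closed curve is assumed to be a Jordan curve. A side is inward if it is concave with respect to the interior of the $n$-gon in the Euclidean sense: it is a genuine circular arc and, near the relative interior of the arc, the $n$-gon's interior lies on the side of the arc outside the circle containing the arc. A side is outward if it is convex with respect to the interior of the $n$-gon in the Euclidean sense: near the relative interior of the arc, the $n$-gon's interior lies inside the circle containing the arc. A side that is a Euclidean line segment counts as outward. The angle measure of a side is the central angle in $[0,\pi]$ subtended by the arc in the Euclidean circle containing it (equivalently, the angle through which its tangent vector turns); it is $0$ for a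 Euclidean line segment. *)

theory Defs
  imports "HOL-Complex_Analysis.Complex_Analysis"
begin

text \<open>The Poincare disc is \<open>ball 0 1 :: complex set\<close>.\<close>

definition hyperbolic_area :: "complex set \<Rightarrow> real" where
  "hyperbolic_area R = (LINT z:R|lborel. (2 / (1 - (Re z)\<^sup>2 - (Im z)\<^sup>2))\<^sup>2)"

text \<open>
  \<open>Segment a b\<close> runs along \<open>linepath a b\<close>; \<open>Arc c r s t\<close> runs along \<open>part_circlepath c r s t\<close>,
  i.e. along the circle with centre \<open>c\<close> and radius \<open>r\<close> from polar angle \<open>s\<close> (about \<open>c\<close>) to \<open>t\<close>.
\<close>

datatype side = Segment complex complex | Arc complex real real real

fun side_path :: "side \<Rightarrow> real \<Rightarrow> complex" where
  "side_path (Segment a b) = linepath a b"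
| "side_path (Arc c r s t) = part_circlepath c r s t"

text \<open>
  Two circles meet at right angles at \<open>p\<close> iff their radii at \<open>p\<close> are perpendicular.
\<close>

definition orthogonal_to_unit_circle :: "complex \<Rightarrow> real \<Rightarrow> bool" where
  "orthogonal_to_unit_circle c r \<longleftrightarrow>
     r > 0 \<and> sphere c r \<inter> sphere 0 1 \<noteq> {} \<and>
     (\<forall>p \<in> sphere c r \<inter> sphere 0 1. orthogonal (p - c) (p - 0))"

fun geodesic_side :: "side \<Rightarrow> bool" where
  "geodesic_side (Segment a b) \<longleftrightarrow>
     a \<noteq> b \<and> collinear {0, a, b} \<and> closed_segment a b \<subseteq> ball 0 1"
| "geodesic_side (Arc c r s t) \<longleftrightarrow>
     s \<noteq> t \<and> orthogonal_to_unit_circle c r \<and> path_image (part_circlepath c r s t) \<subseteq> ball 0 1"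

definition geodesic_from_to :: "side \<Rightarrow> complex \<Rightarrow> complex \<Rightarrow> bool" where
  "geodesic_from_to S a b \<longleftrightarrow>
     geodesic_side S \<and> pathstart (side_path S) = a \<and> pathfinish (side_path S) = b"

text \<open>
  The part of an orthogonal circle inside the unit disc is shorter than a semicircle, so for
  a geodesic arc \<open>\<bar>t - s\<bar> < pi\<close> and \<open>\<bar>t - s\<bar>\<close> is the central angle in \<open>[0, pi]\<close>.
\<close>

fun angle_measure :: "side \<Rightarrow> real" where
  "angle_measure (Segment a b) = 0"
| "angle_measure (Arc c r s t) = \<bar>t - s\<bar>"

fun join_upto :: "(nat \<Rightarrow> real \<Rightarrow> complex) \<Rightarrow> nat \<Rightarrow> real \<Rightarrow> complex" where
  "join_upto p 0 = p 0"
| "join_upto p (Suc k) = join_upto p k +++ p (Suc k)"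

definition boundary_curve :: "nat \<Rightarrow> (nat \<Rightarrow> side) \<Rightarrow> real \<Rightarrow> complex" where
  "boundary_curve n S = join_upto (\<lambda>k. side_path (S k)) (n - 1)"

definition jordan_curve :: "(real \<Rightarrow> complex) \<Rightarrow> bool" where
  "jordan_curve g \<longleftrightarrow> simple_path g \<and> pathfinish g = pathstart g"

text \<open>
  Vertices \<open>z 0, ..., z (n - 1)\<close>; the side \<open>S k\<close> joins \<open>z k\<close> to its cyclic successor.
\<close>

definition hyperbolic_ngon :: "nat \<Rightarrow> (nat \<Rightarrow> complex) \<Rightarrow> (nat \<Rightarrow> side) \<Rightarrow> bool" where
  "hyperbolic_ngon n z S \<longleftrightarrow>
     (\<forall>k<n. z k \<in> ball 0 1) \<and>
     (\<forall>k<n. z k \<noteq> z (Suc k mod n)) \<and>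
     (\<forall>k<n. geodesic_from_to (S k) (z k) (z (Suc k mod n))) \<and>
     jordan_curve (boundary_curve n S)"

definition ngon_region :: "nat \<Rightarrow> (nat \<Rightarrow> side) \<Rightarrow> complex set" where
  "ngon_region n S = inside (path_image (boundary_curve n S))"

definition relative_interior_of_side :: "side \<Rightarrow> complex set" where
  "relative_interior_of_side S =
     path_image (side_path S) - {pathstart (side_path S), pathfinish (side_path S)}"

fun inward :: "complex set \<Rightarrow> side \<Rightarrow> bool" where
  "inward R (Segment a b) \<longleftrightarrow> False"
| "inward R (Arc c r s t) \<longleftrightarrow>
     (\<forall>p \<in> relative_interior_of_side (Arc c r s t). \<exists>e>0. R \<inter> ball p e \<subseteq> - cball c r)"

fun outward :: "complex set \<Rightarrow> side \<Rightarrow> bool" where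
  "outward R (Segment a b) \<longleftrightarrow> True"
| "outward R (Arc c r s t) \<longleftrightarrow>
     (\<forall>p \<in> relative_interior_of_side (Arc c r s t). \<exists>e>0. R \<inter> ball p e \<subseteq> ball c r)"

end

theory Submission
  imports Defs
begin

text \<open>
  The area is \<open>\<epsilon>\<close> times the integral over the disc of the hyperbolic density against the winding
  number of the boundary, where \<open>\<epsilon> = \<plusminus>1\<close> is its constant value on the inside. The winding number is
  a sum of integrals of \<open>dz / (z - w)\<close> over the sides, and Fubini turns each contribution into the
  integral along the side of \<open>2 cnj z / (\<i> (1 - \<bar>z\<bar>\<^sup>2)) dz\<close>, since the Cauchy transform of the density is
  \<open>4 pi cnj z / (1 - \<bar>z\<bar>\<^sup>2)\<close>. On a circle orthogonal to the unit circle the real part of this form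
  is \<open>- d\<theta>\<close>, and on a diameter it vanishes. So the area is \<open>\<epsilon>\<close> times the sum of \<open>s - t\<close> over the
  arcs, and the jump of the winding number across an arc tells that the arc is outward
  iff \<open>\<epsilon>\<close> is the sign of \<open>t - s\<close>.
\<close>

section \<open>Lebesgue measure on the complex plane\<close>

text \<open>The polygon is given only as the inside of a Jordan curve, so the link between the
  region and its individual sides has to be the winding number; no triangulation enters. A single
  side is an open path whose winding number is in general not an integer, but its share of the area
  integral still makes sense, because 1 / (z - w) is locally integrable in the plane. The obstacle
  is that the density is unbounded on the disc, whereas the Fubini step wants a bounded weight of
  bounded support. The boundary curve is compact, hence contained in some \<open>ball 0 R\<close>
  with \<open>R < 1\<close>, and the density is cut off at \<open>R\<close>. By rotational symmetry
  the mass beyond the circle through z contributes nothing to the Cauchy transform at z, so the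
  formula for it is independent of \<open>R\<close>. Only real parts of the side integrals are
  evaluated: the imaginary part of the form is d log (1 - |z|^2), which cancels around a closed
  curve.\<close>

lemma lborel_complex_eq_distr:
  "(lborel :: complex measure) = distr lborel borel (\<lambda>v::real^2. Complex (vec_nth v 1) (vec_nth v 2))"
proof (rule lborel_eqI)
  have T: "(\<lambda>v::real^2. Complex (vec_nth v 1) (vec_nth v 2)) \<in> borel_measurable borel"
    by (intro borel_measurable_continuous_onI) (auto simp: Complex_eq intro!: continuous_intros)
  show "sets (distr lborel borel (\<lambda>v::real^2. Complex (vec_nth v 1) (vec_nth v 2))) = sets borel" by simp
  fix l u :: complex assume le: "\<And>b. b \<in> Basis \<Longrightarrow> l \<bullet> b \<le> u \<bullet> b"
  have l: "Re l \<le> Re u" "Im l \<le> Im u" using le[of 1] le[of \<i>] by (auto simp: Basis_complex_def)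
  have *: "(\<lambda>v::real^2. Complex (vec_nth v 1) (vec_nth v 2)) -` box l u =
      box (vector [Re l, Im l]) (vector [Re u, Im u])"
    by (auto simp: box_def Basis_complex_def inner_complex_def Basis_vec_def inner_axis forall_2)
  have "emeasure (distr lborel borel (\<lambda>v::real^2. Complex (vec_nth v 1) (vec_nth v 2))) (box l u)
     = emeasure lborel (box (vector [Re l, Im l]) (vector [Re u, Im u]) :: (real^2) set)"
    using T by (subst emeasure_distr) (auto simp: * )
  also have "\<dots> = ennreal (\<Prod>b\<in>Basis. ((vector [Re u, Im u] :: real^2) - vector [Re l, Im l]) \<bullet> b)"
  proof (rule emeasure_lborel_box)
    fix b :: "real^2" assume "b \<in> Basis"
    then obtain i where b: "b = axis i 1" by (auto simp: Basis_vec_def)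
    show "vector [Re l, Im l] \<bullet> b \<le> vector [Re u, Im u] \<bullet> b"
      using l exhaust_2[of i] by (auto simp: b inner_axis)
  qed
  also have "(\<Prod>b\<in>Basis. ((vector [Re u, Im u] :: real^2) - vector [Re l, Im l]) \<bullet> b) = (\<Prod>b\<in>Basis. (u - l) \<bullet> b)"
    by (simp add: Basis_vec_def Basis_complex_def UNIV_2 inner_axis axis_eq_axis inner_complex_def)
  finally show "emeasure (distr lborel borel (\<lambda>v::real^2. Complex (vec_nth v 1) (vec_nth v 2))) (box l u) =
      (\<Prod>b\<in>Basis. (u - l) \<bullet> b)" .
qed

text \<open>Invariance under orthogonal maps is taken from \<open>measure_orthogonal_image\<close>
  on \<open>real^2\<close> and carried over by the coordinate map \<open>T\<close>. In coordinates
  \<open>f\<close> is multiplication by \<open>cnj c\<close>, the inverse of multiplication by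
  \<open>c\<close>, so the preimage of a box under the rotation is the image of a box under
  \<open>f\<close>.\<close>

lemma lborel_distr_rotation:
  fixes c :: complex
  assumes "norm c = 1"
  shows "distr lborel borel ((*) c) = lborel"
proof (rule sym, rule lborel_eqI)
  show "sets (distr lborel borel ((*) c)) = sets borel" by simp
  define T where "T = (\<lambda>v::real^2. Complex (vec_nth v 1) (vec_nth v 2))"
  define U where "U = (\<lambda>z. vector [Re z, Im z] :: real^2)"
  have UT: "U (T v) = v" for v by (auto simp: U_def T_def vec_eq_iff forall_2)
  have TU: "T (U v) = v" for v by (auto simp: U_def T_def)
  have Tm[measurable]: "T \<in> borel_measurable borel"
    unfolding T_def
    by (intro borel_measurable_continuous_onI) (auto simp: Complex_eq intro!: continuous_intros)
  have cm[measurable]: "(*) c \<in> borel_measurable borel" by measurable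
  have em: "emeasure lborel A = emeasure lborel (T -` A)" if [measurable]: "A \<in> sets borel" for A
    by (subst lborel_complex_eq_distr, subst emeasure_distr) (auto simp: T_def[symmetric])
  have cc: "c \<noteq> 0" "c * cnj c = 1" using assms
    by (auto simp: complex_norm_square[symmetric] simp del: of_real_power)
  have cc': "c * (cnj c * x) = x" "cnj c * (c * x) = x" for x
    using cc(2) by (simp_all add: mult.assoc[symmetric] mult.commute[of "cnj c" c])
  define f where "f = (\<lambda>v. U (cnj c * T v))"
  have lin: "linear f"
    by (rule linearI) (auto simp: f_def U_def T_def vec_eq_iff forall_2 algebra_simps)
  have nU: "norm (U z) = norm z" for z
    by (simp add: U_def norm_vec_def L2_set_def UNIV_2 cmod_def)
  have nT: "norm (T z) = norm z" for z
    by (metis nU UT)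
  have orth: "orthogonal_transformation f"
    unfolding orthogonal_transformation using lin
    by (auto simp: f_def nU nT norm_mult assms)
  fix l u :: complex assume le: "\<And>b. b \<in> Basis \<Longrightarrow> l \<bullet> b \<le> u \<bullet> b"
  have "T -` ((*) c -` box l u) = f ` (T -` box l u)"
  proof (intro set_eqI iffI)
    fix v assume "v \<in> T -` ((*) c -` box l u)"
    then have "U (c * T v) \<in> T -` box l u" by (simp add: TU)
    moreover have "f (U (c * T v)) = v" by (simp add: f_def TU UT cc')
    ultimately show "v \<in> f ` (T -` box l u)" by (metis imageI)
  next
    fix v assume "v \<in> f ` (T -` box l u)"
    then show "v \<in> T -` ((*) c -` box l u)" by (auto simp: f_def TU cc')
  qed
  note eq = this
  have Tb: "T -` box l u = box (U l) (U u)"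
    by (auto simp: box_def Basis_complex_def inner_complex_def Basis_vec_def inner_axis forall_2 T_def U_def)
  have lm: "T -` box l u \<in> lmeasurable" unfolding Tb by simp
  have [measurable]: "(*) c -` box l u \<in> sets borel"
    using measurable_sets[OF cm, of "box l u"] by simp
  have [measurable]: "f ` (T -` box l u) \<in> sets borel"
    unfolding eq[symmetric] using measurable_sets[OF Tm, of "(*) c -` box l u"] by simp
  have "emeasure (distr lborel borel ((*) c)) (box l u) = emeasure lborel ((*) c -` box l u)"
    by (subst emeasure_distr) auto
  also have "\<dots> = emeasure lborel (f ` (T -` box l u))" by (subst em) (auto simp: eq)
  also have "\<dots> = emeasure lebesgue (f ` (T -` box l u))" by simp
  also have "\<dots> = ennreal (measure lebesgue (f ` (T -` box l u)))"
    by (intro emeasure_eq_measure2) (rule measurable_orthogonal_image[OF orth lm])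
  also have "\<dots> = ennreal (measure lebesgue (T -` box l u))"
    using measure_orthogonal_image[OF orth lm] by simp
  also have "\<dots> = emeasure lebesgue (T -` box l u)"
    by (intro emeasure_eq_measure2[symmetric]) (rule lm)
  also have "\<dots> = emeasure lborel (T -` box l u)" unfolding Tb by simp
  also have "\<dots> = emeasure lborel (box l u)" by (subst em) auto
  finally show "emeasure (distr lborel borel ((*) c)) (box l u) = (\<Prod>b\<in>Basis. (u - l) \<bullet> b)"
    using le by simp
qed

text \<open>The disc of radius \<open>sqrt a\<close> has area \<open>pi * a\<close>, which is linear
  in \<open>a\<close>; hence the squared norm, rather than the norm, has a constant density on the
  half-line. This takes the place of polar coordinates for radial integrands.\<close>

lemma distr_norm_power2_complex:
  "distr lborel borel (\<lambda>w::complex. (norm w)\<^sup>2) =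
   density lborel (\<lambda>s::real. ennreal pi * indicator {0..} s)"
proof (rule measure_eqI_generator_eq[where E = "range atMost" and \<Omega> = UNIV and A = "\<lambda>i. {..real i}"])
  show "Int_stable (range atMost :: real set set)"
    by (auto simp: Int_stable_def)
next
  fix X :: "real set" assume "X \<in> range atMost"
  then obtain a where X: "X = {..a}" by auto
  have [measurable]: "(\<lambda>w::complex. (norm w)\<^sup>2) \<in> borel_measurable borel" by measurable
  have L: "emeasure (distr lborel borel (\<lambda>w::complex. (norm w)\<^sup>2)) X = emeasure lborel ((\<lambda>w::complex. (norm w)\<^sup>2) -` {..a})"
    unfolding X by (subst emeasure_distr) auto
  have R: "emeasure (density lborel (\<lambda>s::real. ennreal pi * indicator {0..} s)) X = ennreal pi * emeasure lborel {0..a}"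
  proof -
    have "emeasure (density lborel (\<lambda>s::real. ennreal pi * indicator {0..} s)) X =
      (\<integral>\<^sup>+ s. ennreal pi * indicator {0..a} s \<partial>lborel)"
      unfolding X by (subst emeasure_density) (auto intro!: nn_integral_cong simp: indicator_def)
    then show ?thesis by (simp add: nn_integral_cmult)
  qed
  show "emeasure (distr lborel borel (\<lambda>w::complex. (norm w)\<^sup>2)) X = emeasure (density lborel (\<lambda>s::real. ennreal pi * indicator {0..} s)) X"
  proof (cases "a \<ge> 0")
    case True
    have "(\<lambda>w::complex. (norm w)\<^sup>2) -` {..a} = cball 0 (sqrt a)"
      using True by (auto simp: dist_norm) (metis norm_ge_zero real_le_rsqrt, metis norm_ge_zero power_mono real_sqrt_pow2)
    then show ?thesis unfolding L R
      using True emeasure_cball[of "sqrt a" "0::complex"]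
      by (simp add: ennreal_mult[symmetric] unit_ball_vol_2)
  next
    case False
    have "\<not> (norm w)\<^sup>2 \<le> a" for w :: complex using False by (smt (verit) zero_le_power2)
    then have "(\<lambda>w::complex. (norm w)\<^sup>2) -` {..a} = {}" by auto
    then show ?thesis using False unfolding L R by simp
  qed
next
  have b: "sets borel = sigma_sets UNIV (range (atMost :: real \<Rightarrow> _))"
    by (subst borel_eq_atMost) (rule sets_measure_of, simp)
  show "sets (distr lborel borel (\<lambda>w::complex. (norm w)\<^sup>2)) = sigma_sets UNIV (range atMost)"
    unfolding b[symmetric] by simp
  show "sets (density lborel (\<lambda>s::real. ennreal pi * indicator {0..} s)) = sigma_sets UNIV (range atMost)"
    unfolding b[symmetric] by simp
  show "(\<Union>i. {..real i}) = UNIV" using real_arch_simple by auto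
  fix i
  have "(\<lambda>w::complex. (norm w)\<^sup>2) -` {..real i} \<subseteq> cball 0 (sqrt i)"
    by (auto simp: real_le_rsqrt)
  then have "emeasure lborel ((\<lambda>w::complex. (norm w)\<^sup>2) -` {..real i}) \<le> emeasure lborel (cball 0 (sqrt i) :: complex set)"
    by (intro emeasure_mono) auto
  also have "\<dots> < \<infinity>" by (simp add: emeasure_cball)
  finally show "emeasure (distr lborel borel (\<lambda>w::complex. (norm w)\<^sup>2)) {..real i} \<noteq> \<infinity>"
    by (subst emeasure_distr) auto
  show "range (\<lambda>i. {..real i}) \<subseteq> range atMost" by blast
qed simp

section \<open>Cauchy transforms and winding numbers\<close>

text \<open>In the variable \<open>s\<close>, the squared norm, the integrand becomes
  \<open>s powr (-1/2)\<close>, which is integrable at 0. The singularity of the Cauchy kernel is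
  thus harmless in dimension two.\<close>

lemma integrable_inverse_norm_ball:
  "integrable lborel (\<lambda>w::complex. indicator (ball 0 1) w / norm w)"
proof -
  define h :: "real \<Rightarrow> real" where "h s = indicator {..<1} s * (s powr (-1/2))" for s
  have hm[measurable]: "h \<in> borel_measurable borel" unfolding h_def by measurable
  have n2: "(\<lambda>w::complex. (norm w)\<^sup>2) \<in> borel_measurable borel" by measurable
  \<comment> \<open>At \<open>w = 0\<close> both sides are 0, by the default values
    \<open>1 / 0 = 0\<close> and \<open>0 powr x = 0\<close>.\<close>
  have eq: "indicator (ball 0 1) w / norm w = h ((norm w)\<^sup>2)" for w :: complex
  proof (cases "w = 0")
    case False
    then have p: "(norm w)\<^sup>2 = norm w powr 2" by simp
    have "((norm w)\<^sup>2) powr (-1/2) = norm w powr (-1)"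
      unfolding p powr_powr by simp
    also have "\<dots> = 1 / norm w"
      by (simp add: powr_minus_divide)
    finally have "((norm w)\<^sup>2) powr (-1/2) = 1 / norm w" .
    then show ?thesis by (auto simp: h_def indicator_def abs_square_less_1)
  qed (simp add: h_def)
  have I: "((\<lambda>x::real. x powr (-1/2)) has_integral 2) {0..1}"
    using has_integral_powr_from_0[of "-1/2" 1] by simp
  have "((\<lambda>x::real. if x \<in> {0..1} then x powr (-1/2) else 0) has_integral 2) UNIV"
    unfolding has_integral_restrict_UNIV by (rule I)
  then have J: "(\<integral>\<^sup>+ x. ennreal (if x \<in> {0..1::real} then x powr (-1/2) else 0) \<partial>lborel) = 2"
    using nn_integral_has_integral_lborel[of "\<lambda>x::real. if x \<in> {0..1} then x powr (-1/2) else 0" 2] by simp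
  have "(\<integral>\<^sup>+ w. ennreal (norm (indicator (ball 0 1) w / norm (w::complex))) \<partial>lborel)
      = (\<integral>\<^sup>+ w. ennreal (h ((norm (w::complex))\<^sup>2)) \<partial>lborel)"
    unfolding eq by (intro nn_integral_cong) (simp add: h_def)
  also have "\<dots> = (\<integral>\<^sup>+ s. ennreal (h s) \<partial>distr lborel borel (\<lambda>w::complex. (norm w)\<^sup>2))"
    using n2 by (subst nn_integral_distr) auto
  also have "\<dots> = (\<integral>\<^sup>+ s. ennreal pi * indicator {0..} s * ennreal (h s) \<partial>lborel)"
    unfolding distr_norm_power2_complex by (subst nn_integral_density) auto
  also have "\<dots> \<le> (\<integral>\<^sup>+ s. ennreal pi * ennreal (if s \<in> {0..1} then s powr (-1/2) else 0) \<partial>lborel)"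
    by (intro nn_integral_mono) (auto simp: h_def indicator_def)
  also have "\<dots> = ennreal pi * 2" using J by (subst nn_integral_cmult) auto
  finally have "(\<integral>\<^sup>+ w. ennreal (norm (indicator (ball 0 1) w / norm (w::complex))) \<partial>lborel) < \<infinity>"
    by (simp add: ennreal_mult_less_top order_le_less_trans)
  moreover have "(\<lambda>w::complex. indicator (ball 0 1) w / norm w) \<in> borel_measurable lborel"
    by (intro borel_measurable_divide borel_measurable_indicator) auto
  ultimately show ?thesis by (intro integrableI_bounded)
qed

lemma lborel_distr_reflect:
  "distr lborel borel (\<lambda>w::complex. z - w) = lborel"
  using lborel_affine[of "-1" z] by (simp add: density_1)

text \<open>The point is that \<open>C\<close> does not depend on \<open>z\<close>: this keeps the
  double integral along a path finite even where the path crosses the support of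
  \<open>\<kappa>\<close>. Near \<open>z\<close> the kernel is dominated by
  \<open>\<phi> (z - w)\<close>, whose integral is the same for all \<open>z\<close> since
  \<open>lborel\<close> is invariant under w \<mapsto> z - w; elsewhere the kernel is at most
  1.\<close>

lemma cauchy_kernel_bounds:
  fixes \<kappa> :: "complex \<Rightarrow> real"
  assumes [measurable]: "\<kappa> \<in> borel_measurable borel"
    and bd: "\<And>w. \<bar>\<kappa> w\<bar> \<le> B" and supp: "\<And>w. w \<notin> ball 0 R \<Longrightarrow> \<kappa> w = 0"
  obtains C where "\<And>z. integrable lborel (\<lambda>w. \<kappa> w *\<^sub>R (1 / (z - w)))"
    and "\<And>z. (LINT w|lborel. norm (\<kappa> w *\<^sub>R (1 / (z - w)))) \<le> C"
proof -
  define \<phi> where "\<phi> u = indicator (ball 0 1) u / norm u" for u :: complex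
  have \<phi>: "integrable lborel \<phi>" unfolding \<phi>_def by (rule integrable_inverse_norm_ball)
  then have [measurable]: "\<phi> \<in> borel_measurable borel" by auto
  have m: "(\<lambda>w. z - w) \<in> borel_measurable borel" for z :: complex by measurable
  have shift: "integrable lborel (\<lambda>w. \<phi> (z - w))" "(LINT w|lborel. \<phi> (z - w)) = (LINT w|lborel. \<phi> w)" for z
  proof -
    have "integrable (distr lborel borel (\<lambda>w. z - w)) \<phi>" using \<phi> by (simp add: lborel_distr_reflect)
    then show "integrable lborel (\<lambda>w. \<phi> (z - w))" using m by (subst (asm) integrable_distr_eq) auto
    have "(LINT w|lborel. \<phi> w) = (LINT w|distr lborel borel (\<lambda>w. z - w). \<phi> w)"
      by (simp add: lborel_distr_reflect)
    then show "(LINT w|lborel. \<phi> (z - w)) = (LINT w|lborel. \<phi> w)"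
      using m by (subst (asm) integral_distr) auto
  qed
  have ball: "integrable lborel (indicator (ball 0 R) :: complex \<Rightarrow> real)"
    using emeasure_bounded_finite[OF bounded_ball[of "0::complex" R]] by (intro integrable_real_indicator) auto
  have B0: "B \<ge> 0" using bd[of 0] by linarith
  define H where "H z w = B * (indicator (ball 0 R) w + \<phi> (z - w))" for z w :: complex
  have Hint: "integrable lborel (H z)" for z
    unfolding H_def using ball shift by auto
  have le: "norm (\<kappa> w *\<^sub>R (1 / (z - w))) \<le> H z w" for z w
  proof (cases "w \<in> ball 0 R")
    case True
    have "1 / norm (z - w) \<le> 1 + \<phi> (z - w)"
      by (cases "norm (z - w) < 1") (auto simp: \<phi>_def indicator_def divide_le_eq)
    then have "\<bar>\<kappa> w\<bar> * (1 / norm (z - w)) \<le> B * (1 + \<phi> (z - w))"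
      using bd B0 by (intro mult_mono) auto
    then show ?thesis using True by (simp add: H_def norm_divide)
  next
    case False
    then show ?thesis using B0 by (simp add: H_def supp \<phi>_def indicator_def)
  qed
  have int: "integrable lborel (\<lambda>w. \<kappa> w *\<^sub>R (1 / (z - w)))" for z
    by (rule Bochner_Integration.integrable_bound[OF Hint[of z]]) (use order_trans[OF le abs_ge_self] in \<open>auto simp del: norm_scaleR\<close>)
  have "(LINT w|lborel. norm (\<kappa> w *\<^sub>R (1 / (z - w)))) \<le> (LINT w|lborel. H z w)" for z
    by (intro integral_mono integrable_norm int Hint le)
  also have "(LINT w|lborel. H z w) = B * ((LINT w|lborel. indicator (ball (0::complex) R) w) + (LINT w|lborel. \<phi> w))" for z
    unfolding H_def using ball shift by simp
  finally show thesis using int that by blast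
qed

text \<open>For smooth \<open>\<kappa>\<close> of compact support this is the solution, vanishing at
  infinity, of the d-bar equation with right-hand side pi times \<open>\<kappa>\<close>. At
  \<open>w = z\<close> the kernel has the default value 0.\<close>

definition cauchy_transform :: "(complex \<Rightarrow> real) \<Rightarrow> complex \<Rightarrow> complex" where
  "cauchy_transform \<kappa> z = (LINT w|lborel. \<kappa> w *\<^sub>R (1 / (z - w)))"

text \<open>
  Unlike \<^const>\<open>winding_number\<close>, which is arbitrary on the path itself, \<open>winding_integral\<close> is
  Borel measurable in the last argument.
\<close>

definition winding_integral :: "(real \<Rightarrow> complex) \<Rightarrow> (real \<Rightarrow> complex) \<Rightarrow> complex \<Rightarrow> complex" where
  "winding_integral g g' w = (LINT t:{0..1}|lborel. g' t / (g t - w)) / (2 * pi * \<i>)"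

lemma winding_integral_eq:
  assumes "valid_path g" and g': "continuous_on {0..1} g'"
    and d: "\<And>t. (g has_vector_derivative g' t) (at t)" and w: "w \<notin> path_image g"
  shows "winding_integral g g' w = winding_number g w"
proof -
  have g: "continuous_on {0..1} g" using assms(1) valid_path_imp_path path_def by blast
  have "set_integrable lborel {0..1} (\<lambda>t. g' t / (g t - w))"
    using g g' w by (intro borel_integrable_atLeastAtMost' continuous_intros) (auto simp: path_image_def)
  then have "(LINT t:{0..1}|lborel. g' t / (g t - w)) = integral {0..1} (\<lambda>t. g' t / (g t - w))"
    by (rule set_borel_integral_eq_integral)
  also have "\<dots> = contour_integral g (\<lambda>z. 1 / (z - w))"
    unfolding contour_integral_integral by (intro integral_cong) (simp add: vector_derivative_at[OF d])
  finally show ?thesis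
    using winding_number_valid_path[OF assms(1) w] by (simp add: winding_integral_def)
qed

text \<open>Fubini for the kernel \<open>F\<close>: integrating over \<open>t\<close> first produces
  \<open>winding_integral\<close>, integrating over \<open>w\<close> first produces
  \<open>cauchy_transform\<close>. Absolute integrability comes from the uniform bound of
  \<open>cauchy_kernel_bounds\<close> and the continuity of \<open>g'\<close> on the compact
  parameter interval. The path may be open, so each side can be treated alone.\<close>

lemma integral_winding_integral:
  fixes \<kappa> :: "complex \<Rightarrow> real"
  assumes [measurable]: "\<kappa> \<in> borel_measurable borel"
    and bd: "\<And>w. \<bar>\<kappa> w\<bar> \<le> B" and supp: "\<And>w. w \<notin> ball 0 R \<Longrightarrow> \<kappa> w = 0"
    and g: "continuous_on UNIV g" and g': "continuous_on UNIV g'"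
  shows "integrable lborel (\<lambda>w. \<kappa> w *\<^sub>R winding_integral g g' w)"
    and "(LINT w|lborel. \<kappa> w *\<^sub>R winding_integral g g' w) =
      (LINT t:{0..1}|lborel. g' t * cauchy_transform \<kappa> (g t)) / (2 * pi * \<i>)"
    and "set_integrable lborel {0..1} (\<lambda>t. g' t * cauchy_transform \<kappa> (g t))"
proof -
  have [measurable]: "g \<in> borel_measurable borel" "g' \<in> borel_measurable borel"
    using g g' by (auto intro: borel_measurable_continuous_onI)
  obtain C where C: "\<And>z. integrable lborel (\<lambda>w. \<kappa> w *\<^sub>R (1 / (z - w)))"
    "\<And>z. (LINT w|lborel. norm (\<kappa> w *\<^sub>R (1 / (z - w)))) \<le> C"
    using cauchy_kernel_bounds[OF assms(1-3)] by blast
  define F where "F t w = indicator {0..1} t *\<^sub>R (g' t * (\<kappa> w *\<^sub>R (1 / (g t - w))))" for t :: real and w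
  have Fm: "case_prod F \<in> borel_measurable (lborel \<Otimes>\<^sub>M lborel)"
    unfolding F_def by measurable
  have nF: "(LINT w|lborel. norm (F t w)) = indicator {0..1} t * (norm (g' t) * (LINT w|lborel. norm (\<kappa> w *\<^sub>R (1 / (g t - w)))))" for t
  proof -
    have "norm (F t w) = (indicator {0..1} t * norm (g' t)) * norm (\<kappa> w *\<^sub>R (1 / (g t - w)))" for w
      unfolding F_def norm_scaleR norm_mult by (simp add: mult.assoc)
    then have "(LINT w|lborel. norm (F t w)) = (LINT w|lborel. (indicator {0..1} t * norm (g' t)) * norm (\<kappa> w *\<^sub>R (1 / (g t - w))))"
      by presburger
    also have "\<dots> = (indicator {0..1} t * norm (g' t)) * (LINT w|lborel. norm (\<kappa> w *\<^sub>R (1 / (g t - w))))"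
      by (rule integral_mult_right_zero)
    finally show ?thesis by (simp only: mult.assoc)
  qed
  have dom: "integrable lborel (\<lambda>t. indicator {0..1} t *\<^sub>R (norm (g' t) * C))"
    using g' by (intro borel_integrable_atLeastAtMost'[unfolded set_integrable_def] continuous_intros)
      (auto intro: continuous_on_subset)
  have Fi: "integrable (lborel \<Otimes>\<^sub>M lborel) (case_prod F)"
  proof (rule lborel_pair.Fubini_integrable[OF Fm])
    show "integrable lborel (\<lambda>t. LINT w|lborel. norm (case_prod F (t, w)))"
    proof (rule Bochner_Integration.integrable_bound[OF dom])
      show "(\<lambda>t. LINT w|lborel. norm (case_prod F (t, w))) \<in> borel_measurable lborel"
        using Fm by measurable
      show "AE t in lborel. norm (LINT w|lborel. norm (case_prod F (t, w))) \<le> norm (indicator {0..1} t *\<^sub>R (norm (g' t) * C))"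
      proof (rule AE_I2)
        fix t :: real
        have "0 \<le> (LINT w|lborel. norm (\<kappa> w *\<^sub>R (1 / (g t - w))))" by (rule integral_nonneg_AE) auto
        then show "norm (LINT w|lborel. norm (case_prod F (t, w))) \<le> norm (indicator {0..1} t *\<^sub>R (norm (g' t) * C))"
          using C(2)[of "g t"] by (auto simp: nF indicator_def abs_mult intro!: mult_left_mono)
      qed
    qed
    show "AE t in lborel. integrable lborel (\<lambda>w. case_prod F (t, w))"
      unfolding F_def prod.case
      by (intro AE_I2 integrable_scaleR_right integrable_mult_right C(1))
  qed
  have tw: "(LINT t|lborel. F t w) = (2 * pi * \<i>) * (\<kappa> w *\<^sub>R winding_integral g g' w)" for w
  proof -
    have "F t w = \<kappa> w *\<^sub>R (indicator {0..1} t *\<^sub>R (g' t / (g t - w)))" for t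
      by (simp add: F_def scaleR_conv_of_real)
    then have "(LINT t|lborel. F t w) = \<kappa> w *\<^sub>R (LINT t:{0..1}|lborel. g' t / (g t - w))"
      by (simp only: set_lebesgue_integral_def integral_scaleR_right)
    then show ?thesis
      by (simp add: winding_integral_def)
  qed
  have wt: "(LINT w|lborel. F t w) = indicator {0..1} t *\<^sub>R (g' t * cauchy_transform \<kappa> (g t))" for t
    unfolding F_def cauchy_transform_def integral_scaleR_right integral_mult_right_zero ..
  have "integrable lborel (\<lambda>w. LINT t|lborel. F t w)"
    using lborel_pair.integrable_snd[OF Fi] .
  then have "integrable lborel (\<lambda>w. (1 / (2 * pi * \<i>)) * ((2 * pi * \<i>) * (\<kappa> w *\<^sub>R winding_integral g g' w)))"
    unfolding tw by (rule integrable_mult_right)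
  then show "integrable lborel (\<lambda>w. \<kappa> w *\<^sub>R winding_integral g g' w)" by simp
  have "(LINT w|lborel. LINT t|lborel. F t w) = (LINT t|lborel. LINT w|lborel. F t w)"
    by (rule lborel_pair.Fubini_integral[OF Fi])
  then show "(LINT w|lborel. \<kappa> w *\<^sub>R winding_integral g g' w) =
      (LINT t:{0..1}|lborel. g' t * cauchy_transform \<kappa> (g t)) / (2 * pi * \<i>)"
    unfolding tw wt set_lebesgue_integral_def integral_mult_right_zero by (simp add: field_simps)
  have "integrable lborel (\<lambda>t. LINT w|lborel. F t w)"
    using lborel_pair.integrable_fst'[OF Fi] by simp
  then show "set_integrable lborel {0..1} (\<lambda>t. g' t * cauchy_transform \<kappa> (g t))"
    unfolding wt set_integrable_def .
qed

text \<open>The kernel is homogeneous of degree -1, while \<open>\<kappa>\<close> and Lebesgue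
  measure are invariant under w \<mapsto> u w; the substitution therefore leaves a factor
  \<open>1 / u\<close>.\<close>

lemma cauchy_transform_rotation:
  fixes \<kappa> :: "complex \<Rightarrow> real"
  assumes [measurable]: "\<kappa> \<in> borel_measurable borel"
    and rot: "\<And>u w. norm u = 1 \<Longrightarrow> \<kappa> (u * w) = \<kappa> w" and u: "norm u = 1"
  shows "u * cauchy_transform \<kappa> (u * z) = cauchy_transform \<kappa> z"
proof -
  have m: "(*) u \<in> borel_measurable borel" by measurable
  have u0: "u \<noteq> 0" using u by auto
  have "cauchy_transform \<kappa> (u * z) = (LINT w|distr lborel borel ((*) u). \<kappa> w *\<^sub>R (1 / (u * z - w)))"
    unfolding cauchy_transform_def by (simp add: lborel_distr_rotation[OF u])
  also have "\<dots> = (LINT w|lborel. \<kappa> (u * w) *\<^sub>R (1 / (u * z - u * w)))"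
    using m by (subst integral_distr) auto
  also have "\<dots> = (LINT w|lborel. (1 / u) * (\<kappa> w *\<^sub>R (1 / (z - w))))"
  proof (rule Bochner_Integration.integral_cong[OF refl])
    fix w
    show "\<kappa> (u * w) *\<^sub>R (1 / (u * z - u * w)) = 1 / u * (\<kappa> w *\<^sub>R (1 / (z - w)))"
      using u0 by (cases "z = w") (simp_all add: rot[OF u] scaleR_conv_of_real right_diff_distrib[symmetric])
  qed
  also have "\<dots> = (1 / u) * cauchy_transform \<kappa> z"
    unfolding cauchy_transform_def by (rule integral_mult_right_zero)
  finally show ?thesis using u0 by simp
qed

section \<open>The hyperbolic density\<close>

definition truncated_density :: "real \<Rightarrow> complex \<Rightarrow> real" where
  "truncated_density R w = indicator (ball 0 R) w * (2 / (1 - (norm w)\<^sup>2))\<^sup>2"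

lemma truncated_density_measurable [measurable]: "truncated_density R \<in> borel_measurable borel"
  unfolding truncated_density_def by (intro borel_measurable_times borel_measurable_indicator) auto

lemma truncated_density_outside: "w \<notin> ball 0 R \<Longrightarrow> truncated_density R w = 0"
  by (simp add: truncated_density_def)

lemma truncated_density_bound:
  assumes "R < 1"
  shows "\<bar>truncated_density R w\<bar> \<le> (2 / (1 - R\<^sup>2))\<^sup>2"
proof (cases "w \<in> ball 0 R")
  case True
  then have "norm w < R" by simp
  then have "(norm w)\<^sup>2 \<le> R\<^sup>2" "R\<^sup>2 < 1"
    using assms by (auto intro!: power_mono simp: abs_square_less_1)
      (smt (verit) norm_ge_zero)
  then have "2 / (1 - (norm w)\<^sup>2) \<le> 2 / (1 - R\<^sup>2)" "0 \<le> 2 / (1 - (norm w)\<^sup>2)"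
    by (auto intro!: divide_left_mono mult_pos_pos)
  then show ?thesis using True by (auto simp: truncated_density_def intro!: power_mono)
qed (simp add: truncated_density_outside)

lemma integral_truncated_winding_integral:
  assumes "R < 1" "continuous_on UNIV g" "continuous_on UNIV g'"
  shows "integrable lborel (\<lambda>w. truncated_density R w *\<^sub>R winding_integral g g' w)"
    and "(LINT w|lborel. truncated_density R w *\<^sub>R winding_integral g g' w) =
      (LINT t:{0..1}|lborel. g' t * cauchy_transform (truncated_density R) (g t)) / (2 * pi * \<i>)"
    and "set_integrable lborel {0..1} (\<lambda>t. g' t * cauchy_transform (truncated_density R) (g t))"
proof -
  note * = truncated_density_measurable truncated_density_bound[OF assms(1)] _ assms(2,3)
  show "integrable lborel (\<lambda>w. truncated_density R w *\<^sub>R winding_integral g g' w)"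
    by (rule integral_winding_integral(1)[OF *]) (erule truncated_density_outside)
  show "(LINT w|lborel. truncated_density R w *\<^sub>R winding_integral g g' w) =
      (LINT t:{0..1}|lborel. g' t * cauchy_transform (truncated_density R) (g t)) / (2 * pi * \<i>)"
    by (rule integral_winding_integral(2)[OF *]) (erule truncated_density_outside)
  show "set_integrable lborel {0..1} (\<lambda>t. g' t * cauchy_transform (truncated_density R) (g t))"
    by (rule integral_winding_integral(3)[OF *]) (erule truncated_density_outside)
qed

lemma truncated_density_rotation: "norm u = 1 \<Longrightarrow> truncated_density R (u * w) = truncated_density R w"
  by (simp add: truncated_density_def norm_mult indicator_def)

text \<open>In terms of the squared norm \<open>s\<close> the integrand is 4 / (1 - s)^2 against
  \<open>pi\<close> ds, with antiderivative \<open>4 * pi / (1 - s)\<close>. As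
  \<open>a < R\<close>, the cut-off does not touch the disc, so this is its hyperbolic area and the
  source of the constant 4 pi in the Cauchy transform.\<close>

lemma hyperbolic_disc_integral:
  assumes "0 \<le> a" "a < R" "R < 1"
  shows "(LINT w|lborel. truncated_density R w * indicator (cball 0 a) w) = 4 * pi * a\<^sup>2 / (1 - a\<^sup>2)"
proof -
  have n2: "(\<lambda>w::complex. (norm w)\<^sup>2) \<in> borel_measurable borel" by measurable
  define h :: "real \<Rightarrow> real" where "h s = indicator {..a\<^sup>2} s * (2 / (1 - s))\<^sup>2" for s
  have hm[measurable]: "h \<in> borel_measurable borel" unfolding h_def by measurable
  have "(norm w)\<^sup>2 \<le> a\<^sup>2 \<longleftrightarrow> norm w \<le> a" for w :: complex
    using assms by (simp add: power2_le_iff_abs_le)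
  then have "truncated_density R w * indicator (cball 0 a) w = h ((norm w)\<^sup>2)" for w
    using assms by (auto simp: truncated_density_def h_def indicator_def)
  then have "(LINT w|lborel. truncated_density R w * indicator (cball 0 a) w) = (LINT w|lborel. h ((norm (w::complex))\<^sup>2))"
    by presburger
  also have "\<dots> = (LINT s|distr lborel borel (\<lambda>w::complex. (norm w)\<^sup>2). h s)"
    using n2 by (subst integral_distr) auto
  also have "distr lborel borel (\<lambda>w::complex. (norm w)\<^sup>2) = density lborel (\<lambda>s. ennreal (pi * indicator {0..} s))"
    unfolding distr_norm_power2_complex by (intro arg_cong2[where f = density] refl ext) (simp add: indicator_def)
  also have "(LINT s|density lborel (\<lambda>s. ennreal (pi * indicator {0..} s)). h s) = (LINT s|lborel. (pi * indicator {0..} s) *\<^sub>R h s)"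
    by (rule integral_density) auto
  also have "\<dots> = (LINT s|lborel. 4 * pi / (1 - s)\<^sup>2 * indicator {0..a\<^sup>2} s)"
    by (intro Bochner_Integration.integral_cong refl) (auto simp: h_def indicator_def power_divide)
  also have "\<dots> = 4 * pi / (1 - a\<^sup>2) - 4 * pi / (1 - 0)"
  proof (rule integral_FTC_Icc_real)
    have "a\<^sup>2 < 1" using assms by (simp add: abs_square_less_1)
    then show "((\<lambda>s. 4 * pi / (1 - s)) has_real_derivative 4 * pi / (1 - x)\<^sup>2) (at x)"
      and "isCont (\<lambda>s. 4 * pi / (1 - s)\<^sup>2) x" if "x \<le> a\<^sup>2" for x
      using that by (auto intro!: derivative_eq_intros continuous_intros simp: power2_eq_square)
  qed simp
  also have "\<dots> = 4 * pi * a\<^sup>2 / (1 - a\<^sup>2)"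
  proof -
    have "a\<^sup>2 < 1" using assms by (simp add: abs_square_less_1)
    then show ?thesis by (simp add: field_simps)
  qed
  finally show ?thesis .
qed

lemma sphere_null_sets: "sphere (c::complex) r \<in> null_sets lborel"
  using negligible_sphere[of c r] by (simp add: negligible_iff_null_sets null_sets_completion_iff)

lemma continuous_part_circlepath:
  "continuous_on UNIV (part_circlepath c r s t)"
  "continuous_on UNIV (\<lambda>x. \<i> * r * (of_real t - of_real s) * exp (\<i> * of_real (linepath s t x)) :: complex)"
  unfolding part_circlepath_def linepath_def by (auto intro!: continuous_intros)

text \<open>
  By rotation invariance \<open>z * cauchy_transform \<kappa> z\<close> is constant on the circle of radius \<open>\<bar>z\<bar>\<close>, and
  Fubini for that circle identifies the constant as the area of the disc.
\<close>

lemma cauchy_transform_truncated_density: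
  assumes R: "R < 1" and z: "norm z < R"
  shows "cauchy_transform (truncated_density R) z = 4 * pi * cnj z / (1 - (norm z)\<^sup>2)"
proof -
  let ?\<kappa> = "truncated_density R"
  have rot: "u * cauchy_transform ?\<kappa> (u * z) = cauchy_transform ?\<kappa> z" if "norm u = 1" for u
    by (rule cauchy_transform_rotation[OF truncated_density_measurable truncated_density_rotation that])
  show ?thesis
  proof (cases "z = 0")
    case True
    \<comment> \<open>Rotation by -1 fixes the centre and changes the sign of the transform there,
      which is therefore 0.\<close>
    then show ?thesis using rot[of "-1"] by simp
  next
    case False
    define a where "a = norm z"
    have a: "0 < a" "a < R" using False z by (auto simp: a_def)
    define g where "g = part_circlepath 0 a 0 (2 * pi)"
    define g' where "g' = (\<lambda>x. \<i> * a * (of_real (2 * pi) - of_real 0) * exp (\<i> * of_real (linepath 0 (2 * pi) x)) :: complex)"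
    have gc: "continuous_on UNIV g" "continuous_on UNIV g'"
      unfolding g_def g'_def by (rule continuous_part_circlepath)+
    have gd: "(g has_vector_derivative g' t) (at t)" for t
      unfolding g_def g'_def by (rule has_vector_derivative_part_circlepath)
    have gv: "valid_path g" unfolding g_def by simp
    have gcp: "g = circlepath 0 a" by (simp add: g_def circlepath_def)
    have im: "path_image g = sphere 0 a" using a by (simp add: gcp path_image_circlepath)
    have gg': "g' t = 2 * pi * \<i> * g t" and ng: "norm (g t) = a" for t
      using a by (simp_all add: g_def g'_def part_circlepath_def norm_mult)
    have wn: "winding_integral g g' w = indicator (cball 0 a) w" if "w \<notin> sphere 0 a" for w
    proof -
      have "winding_integral g g' w = winding_number g w"
        using that gc gv gd im by (intro winding_integral_eq) (auto intro: continuous_on_subset)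
      also have "\<dots> = indicator (cball 0 a) w"
      proof (cases "norm w < a")
        case True
        then show ?thesis unfolding gcp by (subst winding_number_circlepath) auto
      next
        case False
        then have "w \<notin> cball 0 a" using that by auto
        then have "winding_number g w = 0"
          using gv im by (intro winding_number_zero_outside[of _ "cball 0 a"]) (auto simp: gcp valid_path_imp_path)
        then show ?thesis using \<open>w \<notin> cball 0 a\<close> by simp
      qed
      finally show ?thesis .
    qed
    note W = integral_truncated_winding_integral[OF R gc]
    \<comment> \<open>On the circle itself the value of \<open>winding_integral\<close> is left
      open; the circle is a null set.\<close>
    have "AE w in lborel. ?\<kappa> w *\<^sub>R winding_integral g g' w = complex_of_real (?\<kappa> w * indicator (cball 0 a) w)"
    proof (rule AE_I'[OF sphere_null_sets[of 0 a]], rule subsetI, rule ccontr)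
      fix w assume "w \<in> {w \<in> space lborel. ?\<kappa> w *\<^sub>R winding_integral g g' w \<noteq> complex_of_real (?\<kappa> w * indicator (cball 0 a) w)}"
        "w \<notin> sphere 0 a"
      then show False using wn[of w] by (cases "norm w \<le> a") (simp_all add: scaleR_conv_of_real)
    qed
    then have "(LINT w|lborel. ?\<kappa> w *\<^sub>R winding_integral g g' w) = (LINT w|lborel. complex_of_real (?\<kappa> w * indicator (cball 0 a) w))"
    proof (intro integral_cong_AE)
      show "(\<lambda>w. ?\<kappa> w *\<^sub>R winding_integral g g' w) \<in> borel_measurable lborel"
        using W(1) by (rule borel_measurable_integrable)
      have "(\<lambda>w. ?\<kappa> w * indicator (cball 0 a) w) \<in> borel_measurable lborel"
        by (intro borel_measurable_times borel_measurable_indicator) auto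
      then show "(\<lambda>w. complex_of_real (?\<kappa> w * indicator (cball 0 a) w)) \<in> borel_measurable lborel"
        by (rule measurable_compose[OF _ borel_measurable_of_real])
    qed
    also have "\<dots> = 4 * pi * a\<^sup>2 / (1 - a\<^sup>2)"
      unfolding integral_complex_of_real using hyperbolic_disc_integral[of a R] a R by simp
    finally have "(LINT t:{0..1}|lborel. g' t * cauchy_transform ?\<kappa> (g t)) / (2 * pi * \<i>) = 4 * pi * a\<^sup>2 / (1 - a\<^sup>2)"
      unfolding W(2) .
    \<comment> \<open>Both \<open>g t\<close> and \<open>z\<close> have norm \<open>a\<close>, so
      \<open>g t / z\<close> is a rotation and the integrand is constant in
      \<open>t\<close>.\<close>
    moreover have "g' t * cauchy_transform ?\<kappa> (g t) = (2 * pi * \<i>) * (z * cauchy_transform ?\<kappa> z)" for t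
      using rot[of "g t / z"] False ng[of t] a_def by (simp add: gg' norm_divide field_simps)
    ultimately have "z * cauchy_transform ?\<kappa> z = 4 * pi * a\<^sup>2 / (1 - a\<^sup>2)"
      by (simp add: set_lebesgue_integral_def)
    also have "\<dots> = z * (4 * pi * cnj z / (1 - (norm z)\<^sup>2))"
      using complex_norm_square[of z] by (simp add: a_def)
    finally show ?thesis unfolding mult_cancel_left using False by blast
  qed
qed

text \<open>Here \<open>X\<close> is a velocity and \<open>Y\<close> the conjugate of a point of
  norm \<open>n\<close>. As 4 pi / (2 pi \<i>) = -2 \<i>, a real coefficient splits off, and the
  real part of a side integrand is this coefficient times \<open>Im (X * Y)\<close>.\<close>

lemma cauchy_density_factor:
  fixes X Y :: complex and n :: real
  shows "X * (4 * pi * Y / (1 - n\<^sup>2)) / (2 * pi * \<i>) = of_real (2 / (1 - n\<^sup>2)) * (- \<i> * (X * Y))"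
proof -
  have "X * (4 * pi * Y / D) / (2 * pi * \<i>) = 2 / D * (- \<i> * (X * Y))" for D
    by (cases "D = 0") (simp_all add: field_simps)
  from this[of "of_real (1 - n\<^sup>2)"] show ?thesis
    by (simp only: of_real_divide of_real_numeral of_real_1 of_real_diff of_real_power of_real_mult)
qed

text \<open>
  The circle is orthogonal to the unit circle, so that \<open>1 - \<bar>z\<bar>\<^sup>2 = -2 r (r + Re (cnj c * cis \<theta>))\<close> on it,
  which cancels against \<open>Im (cnj z * dz) = r (r + Re (cnj c * cis \<theta>)) d\<theta>\<close>.
\<close>

lemma arc_density_integral:
  assumes R: "R < 1" and c: "(norm c)\<^sup>2 = 1 + r\<^sup>2" and im: "path_image (part_circlepath c r s t) \<subseteq> ball 0 R"
  defines "g' \<equiv> \<lambda>x. \<i> * r * (of_real t - of_real s) * exp (\<i> * of_real (linepath s t x)) :: complex"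
  shows "Re (LINT w|lborel. truncated_density R w *\<^sub>R winding_integral (part_circlepath c r s t) g' w) = s - t"
proof -
  let ?g = "part_circlepath c r s t" and ?\<kappa> = "truncated_density R"
  have gc': "continuous_on UNIV g'" unfolding g'_def by (rule continuous_part_circlepath)
  note W = integral_truncated_winding_integral[OF R continuous_part_circlepath(1)[of c r s t] gc']
  have pt: "Re (g' x * cauchy_transform ?\<kappa> (?g x) / (2 * pi * \<i>)) = s - t" if x: "x \<in> {0..1}" for x
  proof -
    define e where "e = exp (\<i> * of_real (linepath s t x))"
    have ne: "norm e = 1" by (simp add: e_def)
    have g: "?g x = c + r * e" by (simp add: part_circlepath_def e_def)
    have n: "norm (c + r * e) < R" using im x unfolding path_image_def g[symmetric] by force
    define q where "q = Re (cnj c * e)"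
    have e2: "(Re e)\<^sup>2 + (Im e)\<^sup>2 = 1" using ne by (simp add: cmod_power2[symmetric])
    have c2: "(Re c)\<^sup>2 + (Im c)\<^sup>2 = 1 + r\<^sup>2" using c by (simp add: cmod_power2)
    have "(norm (c + r * e))\<^sup>2 = ((Re c)\<^sup>2 + (Im c)\<^sup>2) + r\<^sup>2 * ((Re e)\<^sup>2 + (Im e)\<^sup>2) + 2 * r * q"
      by (simp add: cmod_power2 q_def) algebra
    then have nn: "1 - (norm (c + r * e))\<^sup>2 = - 2 * r * (r + q)"
      unfolding e2 c2 by (simp add: algebra_simps power2_eq_square)
    have "0 \<le> norm (c + r * e)" by simp
    then have "(norm (c + r * e))\<^sup>2 < 1" using n R by (simp add: abs_square_less_1 del: norm_ge_zero)
    \<comment> \<open>For a point of the disc the left-hand side of \<open>nn\<close> is positive;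
      this allows the common factor to be cancelled.\<close>
    then have nz: "r * (r + q) \<noteq> 0" using nn by auto
    \<comment> \<open>Up to the factor \<i> r d\<theta> this is cnj z dz on the circle, simplified
      by \<open>e * cnj e = 1\<close>.\<close>
    have "e * cnj (c + r * e) = cnj c * e + r"
      using e2 by (simp add: complex_eq_iff) algebra
    then have "Re (e * cnj (c + r * e)) = r + q" by (simp add: q_def)
    moreover have "Re (of_real k * E) = k * Re E" for k E by simp
    ultimately have "Re (of_real (2 * r * (t - s) / (1 - (norm (c + r * e))\<^sup>2)) * (e * cnj (c + r * e))) = 2 * r * (t - s) / (1 - (norm (c + r * e))\<^sup>2) * (r + q)"
      by presburger
    also have "\<dots> = s - t" unfolding nn using nz by (simp add: field_simps)
    finally have 1: "Re (of_real (2 * r * (t - s) / (1 - (norm (c + r * e))\<^sup>2)) * (e * cnj (c + r * e))) = s - t" .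
    have "g' x * cauchy_transform ?\<kappa> (?g x) / (2 * pi * \<i>) = of_real (2 * r * (t - s) / (1 - (norm (c + r * e))\<^sup>2)) * (e * cnj (c + r * e))"
    proof -
      have h: "of_real (2 / D) * (- \<i> * (\<i> * r * (of_real t - of_real s) * e * Y)) = of_real (2 * r * (t - s) / D) * (e * Y)" for D Y
        by (cases "D = 0") (simp_all add: field_simps)
      show ?thesis
        unfolding g cauchy_transform_truncated_density[OF R n] g'_def e_def[symmetric] cauchy_density_factor h ..
    qed
    then show ?thesis using 1 by simp
  qed
  have "Re (LINT w|lborel. ?\<kappa> w *\<^sub>R winding_integral ?g g' w) = Re ((LINT x:{0..1}|lborel. g' x * cauchy_transform ?\<kappa> (?g x)) / (2 * pi * \<i>))"
    by (simp only: W(2))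
  also have "\<dots> = Re (LINT x|lborel. indicator {0..1} x *\<^sub>R (g' x * cauchy_transform ?\<kappa> (?g x)) / (2 * pi * \<i>))"
    unfolding set_lebesgue_integral_def by (subst integral_divide_zero) simp
  also have "\<dots> = (LINT x|lborel. Re (indicator {0..1} x *\<^sub>R (g' x * cauchy_transform ?\<kappa> (?g x)) / (2 * pi * \<i>)))"
    using W(3) unfolding set_integrable_def by (intro integral_Re[symmetric] integrable_divide_zero) simp
  also have "\<dots> = (LINT (x::real)|lborel. (s - t) * indicator {0..1} x)"
  proof (intro Bochner_Integration.integral_cong refl)
    fix x
    show "Re (indicator {0..1} x *\<^sub>R (g' x * cauchy_transform ?\<kappa> (?g x)) / (2 * pi * \<i>)) = (s - t) * indicator {0..1} x"
      using pt[of x] by (cases "x \<in> {0..1}") simp_all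
  qed
  also have "\<dots> = s - t" by simp
  finally show ?thesis .
qed

text \<open>Collinearity with 0 makes \<open>a * cnj b\<close> real, hence also the velocity times
  the conjugate of any point of the segment. The integrand is -\<i> times a real number.\<close>

lemma diameter_density_integral:
  assumes R: "R < 1" and col: "collinear {0, a, b}" and im: "closed_segment a b \<subseteq> ball 0 R"
  shows "Re (LINT w|lborel. truncated_density R w *\<^sub>R winding_integral (linepath a b) (\<lambda>_. b - a) w) = 0"
proof -
  let ?g = "linepath a b" and ?\<kappa> = "truncated_density R"
  have cont: "continuous_on UNIV ?g" "continuous_on UNIV (\<lambda>_::real. b - a)"
    unfolding linepath_def by (auto intro!: continuous_intros)
  note W = integral_truncated_winding_integral[OF R cont]
  have ab: "Im (a * cnj b) = 0"
  proof -
    from col have "a = 0 \<or> b = 0 \<or> (\<exists>u. b = u *\<^sub>R a)" by (simp add: collinear_lemma)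
    then show ?thesis by (auto simp: algebra_simps)
  qed
  have pt: "Re ((b - a) * cauchy_transform ?\<kappa> (?g x) / (2 * pi * \<i>)) = 0" if x: "x \<in> {0..1}" for x
  proof -
    have "?g x \<in> closed_segment a b" using x by (metis linepath_in_path path_image_linepath)
    then have n: "norm (?g x) < R" using im by auto
    have "Im ((b - a) * cnj (?g x)) = 0" using ab by (simp add: linepath_def algebra_simps)
    moreover have "(b - a) * cauchy_transform ?\<kappa> (?g x) / (2 * pi * \<i>) = of_real (2 / (1 - (norm (?g x))\<^sup>2)) * (- \<i> * ((b - a) * cnj (?g x)))"
      unfolding cauchy_transform_truncated_density[OF R n] cauchy_density_factor ..
    moreover have "Re (of_real k * (- \<i> * E)) = k * Im E" for k E by simp
    ultimately show ?thesis by simp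
  qed
  have "Re (LINT w|lborel. ?\<kappa> w *\<^sub>R winding_integral ?g (\<lambda>_. b - a) w) = Re ((LINT x:{0..1}|lborel. (b - a) * cauchy_transform ?\<kappa> (?g x)) / (2 * pi * \<i>))"
    by (simp only: W(2))
  also have "\<dots> = Re (LINT x|lborel. indicator {0..1} x *\<^sub>R ((b - a) * cauchy_transform ?\<kappa> (?g x)) / (2 * pi * \<i>))"
    unfolding set_lebesgue_integral_def by (subst integral_divide_zero) simp
  also have "\<dots> = (LINT x|lborel. Re (indicator {0..1} x *\<^sub>R ((b - a) * cauchy_transform ?\<kappa> (?g x)) / (2 * pi * \<i>)))"
    using W(3) unfolding set_integrable_def by (intro integral_Re[symmetric] integrable_divide_zero) simp
  also have "\<dots> = (LINT (x::real)|lborel. 0)"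
  proof (intro Bochner_Integration.integral_cong refl)
    fix x
    show "Re (indicator {0..1} x *\<^sub>R ((b - a) * cauchy_transform ?\<kappa> (?g x)) / (2 * pi * \<i>)) = 0"
      using pt[of x] by (cases "x \<in> {0..1}") simp_all
  qed
  finally show ?thesis by simp
qed

section \<open>Closed curves with several sides\<close>

lemma pathstart_join_upto: "pathstart (join_upto p m) = pathstart (p 0)"
  by (induction m) auto

lemma pathfinish_join_upto: "pathfinish (join_upto p m) = pathfinish (p m)"
  by (induction m) auto

lemma path_image_join_upto:
  assumes "\<And>k. k < m \<Longrightarrow> pathfinish (p k) = pathstart (p (Suc k))"
  shows "path_image (join_upto p m) = (\<Union>k\<le>m. path_image (p k))"
  using assms
  by (induction m) (auto simp: path_image_join pathfinish_join_upto atMost_Suc)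

lemma path_join_upto:
  assumes "\<And>k. k < m \<Longrightarrow> pathfinish (p k) = pathstart (p (Suc k))" "\<And>k. k \<le> m \<Longrightarrow> path (p k)"
  shows "path (join_upto p m)"
  using assms by (induction m) (auto simp: pathfinish_join_upto)

lemma winding_number_join_upto:
  assumes "\<And>k. k < m \<Longrightarrow> pathfinish (p k) = pathstart (p (Suc k))" "\<And>k. k \<le> m \<Longrightarrow> path (p k)"
    and "\<And>k. k \<le> m \<Longrightarrow> w \<notin> path_image (p k)"
  shows "winding_number (join_upto p m) w = (\<Sum>k\<le>m. winding_number (p k) w)"
  using assms
proof (induction m)
  case (Suc m)
  have "winding_number (join_upto p m +++ p (Suc m)) w = winding_number (join_upto p m) w + winding_number (p (Suc m)) w"
    using Suc.prems
    by (intro winding_number_join path_join_upto) (auto simp: path_image_join_upto pathfinish_join_upto)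
  then show ?case using Suc by simp
qed simp

text \<open>By \<open>arc_join_eq\<close> the last side meets the union of the earlier ones at most
  in its own starting point; induction yields this for all pairs. It serves for a simple loop whose
  last side has been removed.\<close>

lemma arc_join_upto:
  assumes "\<And>k. k < m \<Longrightarrow> pathfinish (p k) = pathstart (p (Suc k))" and "arc (join_upto p m)"
  shows "j \<le> m \<Longrightarrow> arc (p j)"
    and "i < j \<Longrightarrow> j \<le> m \<Longrightarrow> path_image (p i) \<inter> path_image (p j) \<subseteq> {pathstart (p j)}"
proof -
  have "(\<forall>j\<le>m. arc (p j)) \<and> (\<forall>j\<le>m. \<forall>i<j. path_image (p i) \<inter> path_image (p j) \<subseteq> {pathstart (p j)})"
    using assms
  proof (induction m)
    case (Suc m)
    from Suc.prems have a: "arc (join_upto p m)" "arc (p (Suc m))"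
      "path_image (join_upto p m) \<inter> path_image (p (Suc m)) \<subseteq> {pathstart (p (Suc m))}"
      by (auto simp: arc_join_eq pathfinish_join_upto)
    have im: "path_image (join_upto p m) = (\<Union>k\<le>m. path_image (p k))"
      using Suc.prems by (intro path_image_join_upto) auto
    have "(\<forall>j\<le>m. arc (p j)) \<and> (\<forall>j\<le>m. \<forall>i<j. path_image (p i) \<inter> path_image (p j) \<subseteq> {pathstart (p j)})"
      using Suc.IH Suc.prems(1) a(1) by auto
    moreover have "path_image (p i) \<inter> path_image (p (Suc m)) \<subseteq> {pathstart (p (Suc m))}" if "i < Suc m" for i
    proof -
      have "path_image (p i) \<subseteq> path_image (join_upto p m)" using that unfolding im by (auto simp: less_Suc_eq_le)
      then show ?thesis using a(3) by blast
    qed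
    ultimately show ?case using a(2) by (auto simp: le_Suc_eq)
  qed simp
  then show "j \<le> m \<Longrightarrow> arc (p j)" "i < j \<Longrightarrow> j \<le> m \<Longrightarrow> path_image (p i) \<inter> path_image (p j) \<subseteq> {pathstart (p j)}"
    by blast+
qed

text \<open>Without its last side the loop is an arc, and the last side meets that arc only in its
  own two ends. So a point \<open>x\<close> interior to side \<open>i\<close> and lying on another
  side would be a vertex. If it starts a later side, it also ends the side before that one; meeting
  this neighbour makes it the neighbour's start as well, which contradicts the distinct ends of an
  arc.\<close>

lemma simple_loop_join_upto_disjoint:
  assumes con: "\<And>k. k < m \<Longrightarrow> pathfinish (p k) = pathstart (p (Suc k))"
    and simple: "simple_path (join_upto p m)" and loop: "pathfinish (p m) = pathstart (p 0)"
    and ij: "i \<le> m" "j \<le> m" "i \<noteq> j"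
  shows "(path_image (p i) - {pathstart (p i), pathfinish (p i)}) \<inter> path_image (p j) = {}"
proof (cases m)
  case 0
  then show ?thesis using ij by simp
next
  case (Suc m')
  have "simple_path (join_upto p m' +++ p m)" using simple Suc by simp
  then have a: "arc (join_upto p m')" "arc (p m)"
    "path_image (join_upto p m') \<inter> path_image (p m) \<subseteq> {pathstart (p 0), pathstart (p m)}"
    using con[of m'] loop
    by (auto simp: Suc simple_path_join_loop_eq pathfinish_join_upto pathstart_join_upto)
  have con': "\<And>k. k < m' \<Longrightarrow> pathfinish (p k) = pathstart (p (Suc k))" using con Suc by auto
  have arcs: "arc (p k)" if "k \<le> m'" for k
    by (rule arc_join_upto(1)[OF _ a(1) that]) (rule con')
  have int: "path_image (p h) \<inter> path_image (p k) \<subseteq> {pathstart (p k)}" if "h < k" "k \<le> m'" for h k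
    by (rule arc_join_upto(2)[OF _ a(1) that]) (rule con')
  have im: "path_image (join_upto p m') = (\<Union>k\<le>m'. path_image (p k))"
    by (rule path_image_join_upto) (rule con')
  have last: "path_image (p k) \<inter> path_image (p m) \<subseteq> {pathstart (p 0), pathstart (p m)}" if "k \<le> m'" for k
  proof -
    have "path_image (p k) \<subseteq> path_image (join_upto p m')" using that unfolding im by auto
    then show ?thesis using a(3) by blast
  qed
  have ne: "pathstart (p k) \<noteq> pathfinish (p k)" if "k \<le> m'" for k
    using arcs[OF that] arc_distinct_ends by metis
  have False if x: "x \<in> path_image (p i)" "x \<noteq> pathstart (p i)" "x \<noteq> pathfinish (p i)" "x \<in> path_image (p j)" for x
  proof -
    \<comment> \<open>The closing side \<open>m\<close> has cases of its own, since it can meet the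
      others at both of its ends.\<close>
    consider "i = m" "j \<le> m'" | "j = m" "i \<le> m'" | "i < j" "j \<le> m'" | "j < i" "i \<le> m'"
      using ij Suc by linarith
    then show False
    proof cases
      case 1
      then show False using last[of j] x loop by auto
    next
      case 2
      then have "x = pathstart (p 0) \<or> x = pathstart (p m)" using last[of i] x by auto
      then show False
      proof
        assume x0: "x = pathstart (p 0)"
        have "0 < i" using x x0 by (cases i) auto
        then have "x \<in> {pathstart (p i)}" using int[of 0 i] 2 x x0 by (auto intro: pathstart_in_path_image)
        then show False using x by simp
      next
        assume "x = pathstart (p m)"
        then have xm: "x = pathfinish (p m')" using con[of m'] Suc by simp
        then have "i < m'" using x 2 by (cases "i = m'") auto
        then have "x \<in> {pathstart (p m')}" using int[of i m'] x xm by (auto intro: pathfinish_in_path_image)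
        then show False using ne[of m'] xm by auto
      qed
    next
      case 3
      then have xj: "x = pathstart (p j)" using int[of i j] x by auto
      obtain j' where j': "j = Suc j'" using 3 by (cases j) auto
      then have xf: "x = pathfinish (p j')" using xj con[of j'] 3 Suc by simp
      then have "i < j'" using x 3 j' by (cases "i = j'") auto
      then have "x \<in> {pathstart (p j')}" using int[of i j'] x xf 3 j' by (auto intro: pathfinish_in_path_image)
      then show False using ne[of j'] xf 3 j' by auto
    next
      case 4
      then show False using int[of j i] x by auto
    qed
  qed
  then show ?thesis by blast
qed

section \<open>Circular arcs\<close>

text \<open>Pythagoras for the triangle 0, \<open>p\<close>, \<open>c\<close>, with its right angle
  at a common point \<open>p\<close> of the two circles.\<close>

lemma norm_centre_orthogonal_circle:
  assumes "orthogonal_to_unit_circle c r"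
  shows "(norm c)\<^sup>2 = 1 + r\<^sup>2"
proof -
  from assms obtain p where p: "dist c p = r" "norm p = 1" "(p - c) \<bullet> p = 0"
    unfolding orthogonal_to_unit_circle_def orthogonal_def by fastforce
  have "(norm c)\<^sup>2 = (norm (p - (p - c)))\<^sup>2" by simp
  also have "\<dots> = (norm p)\<^sup>2 + (norm (p - c))\<^sup>2 - 2 * ((p - c) \<bullet> p)"
    unfolding power2_norm_eq_inner by (simp add: inner_diff_left inner_diff_right inner_commute)
  finally show ?thesis using p by (simp add: dist_norm norm_minus_commute)
qed

lemma sphere_angle_above:
  assumes "q \<in> sphere c r"
  obtains \<theta> :: real where "a \<le> \<theta>" "\<theta> < a + 2 * pi" "q = c + r * cis \<theta>"
proof -
  have r: "norm (q - c) = r" using assms by (simp add: dist_norm norm_minus_commute)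
  define \<phi> where "\<phi> = Arg (q - c)"
  have q: "q = c + r * cis \<phi>" using r rcis_cmod_Arg[of "q - c"] by (simp add: rcis_def \<phi>_def)
  \<comment> \<open>The number of full turns by which the principal argument has to be moved to fall
    into the window beginning at \<open>a\<close>.\<close>
  define k where "k = \<lfloor>(\<phi> - a) / (2 * pi)\<rfloor>"
  have "of_int k \<le> (\<phi> - a) / (2 * pi)" "(\<phi> - a) / (2 * pi) < of_int k + 1"
    unfolding k_def by linarith+
  then have "a \<le> \<phi> - 2 * pi * of_int k" "\<phi> - 2 * pi * of_int k < a + 2 * pi"
    by (auto simp: field_simps)
  moreover have "cis (\<phi> - 2 * pi * of_int k) = cis \<phi>"
    by (simp add: cis_divide[symmetric] cis_multiple_2pi)
  ultimately show thesis using that[of "\<phi> - 2 * pi * of_int k"] q by simp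
qed

text \<open>An arc turning through 2 pi or more would cover the whole circle, including its points
  on the unit circle, but a geodesic side stays in the open disc. This excludes multiple
  turns.\<close>

lemma geodesic_arc_angle_less:
  assumes "geodesic_side (Arc c r s t)"
  shows "\<bar>t - s\<bar> < 2 * pi"
proof (rule ccontr)
  assume "\<not> \<bar>t - s\<bar> < 2 * pi"
  then have long: "min s t + 2 * pi \<le> max s t" by (auto simp: min_def max_def)
  from assms have "sphere c r \<inter> sphere 0 1 \<noteq> {}" by (simp add: orthogonal_to_unit_circle_def)
  then obtain q where q: "q \<in> sphere c r" "q \<in> sphere 0 1" by blast
  obtain \<theta> where "min s t \<le> \<theta>" "\<theta> < min s t + 2 * pi" "q = c + r * cis \<theta>"
    using sphere_angle_above[OF q(1)] by blast
  then have "q \<in> path_image (part_circlepath c r s t)"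
    using long by (auto simp: path_image_part_circlepath' closed_segment_eq_real_ivl min_def max_def split: if_splits)
  then show False using assms q(2) by auto
qed

text \<open>On the circle dz / (z - c) equals \<i> d\<theta>.\<close>

lemma winding_number_part_circlepath_centre:
  assumes "r > 0"
  shows "winding_number (part_circlepath c r s t) c = of_real ((t - s) / (2 * pi))"
proof -
  have nin: "c \<notin> path_image (part_circlepath c r s t)"
    using path_image_part_circlepath_subset'[of r c s t] assms by auto
  have "contour_integral (part_circlepath c r s t) (\<lambda>w. 1 / (w - c)) = integral {0..1} (\<lambda>x::real. \<i> * (of_real t - of_real s))"
    unfolding contour_integral_integral vector_derivative_part_circlepath
    using assms by (intro integral_cong) (simp add: part_circlepath_def)
  also have "\<dots> = \<i> * (of_real t - of_real s)" by simp
  finally have ci: "contour_integral (part_circlepath c r s t) (\<lambda>w. 1 / (w - c)) = \<i> * (of_real t - of_real s)" .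
  show ?thesis
    unfolding winding_number_valid_path[OF valid_path_part_circlepath nin] ci by (simp add: field_simps)
qed

lemma cis_shift: "cis (x + 2 * pi) = cis x" "cis (x - 2 * pi) = cis x"
  by (simp_all add: cis_mult[symmetric] cis_divide[symmetric])

text \<open>The two arcs join to a closed curve on the circle that makes one full turn in the
  direction \<open>\<sigma>\<close>. Its winding number is constant on the open disc, where the
  centre gives the sum of the two angles over 2 pi, and it vanishes off the closed disc by
  convexity.\<close>

lemma winding_number_complementary_arcs:
  fixes s t :: real
  assumes r: "r > 0" and \<sigma>: "\<sigma> = 1 \<or> \<sigma> = -1" and w: "w \<notin> sphere c r"
  shows "winding_number (part_circlepath c r s t) w + winding_number (part_circlepath c r t (s + \<sigma> * (2 * pi))) w
     = of_real (\<sigma> * indicator (ball c r) w)"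
proof -
  let ?p = "part_circlepath c r s t" and ?q = "part_circlepath c r t (s + \<sigma> * (2 * pi))"
  have sub: "path_image ?p \<subseteq> sphere c r" "path_image ?q \<subseteq> sphere c r"
    using r by (simp_all add: path_image_part_circlepath_subset')
  have "exp (\<i> * of_real (s + \<sigma> * (2 * pi))) = cis (s + \<sigma> * (2 * pi))" by (simp add: cis_conv_exp)
  also have "\<dots> = cis s" using \<sigma> by (elim disjE) (simp_all add: cis_shift)
  finally have loop: "pathfinish (?p +++ ?q) = pathstart (?p +++ ?q)" by (simp add: cis_conv_exp)
  have path: "path (?p +++ ?q)" by simp
  have im: "path_image (?p +++ ?q) \<subseteq> sphere c r" using sub by (auto simp: path_image_join)
  have sum: "winding_number (?p +++ ?q) v = winding_number ?p v + winding_number ?q v" if "v \<notin> sphere c r" for v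
    using that sub by (intro winding_number_join) auto
  show ?thesis
  proof (cases "w \<in> ball c r")
    case True
    have "winding_number (?p +++ ?q) w = winding_number (?p +++ ?q) c"
      using True r im by (intro winding_number_eq[OF path loop, where S = "ball c r"]) auto
    also have "\<dots> = of_real \<sigma>"
    proof -
      have "(t - s) / (2 * pi) + (s + \<sigma> * (2 * pi) - t) / (2 * pi) = \<sigma>" by (simp add: field_simps)
      moreover have c: "c \<notin> sphere c r" using r by simp
      ultimately show ?thesis
        unfolding sum[OF c] winding_number_part_circlepath_centre[OF r] of_real_add[symmetric] by simp
    qed
    finally show ?thesis using True w by (simp add: sum)
  next
    case False
    then have "w \<notin> cball c r" using w by auto
    then have "winding_number (?p +++ ?q) w = 0"
      using im by (intro winding_number_zero_outside[OF path convex_cball loop]) auto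
    then show ?thesis using False w by (simp add: sum)
  qed
qed

text \<open>The complementary arc continues in the direction of travel, \<open>sgn (t - s)\<close>,
  until a full turn from \<open>s\<close> is completed. In terms of \<open>lo\<close> and
  \<open>hi\<close> the two arcs have the angles \<open>{lo..hi}\<close> and
  \<open>{hi..lo + 2 * pi}\<close> for either orientation; when \<open>t < s\<close>, this takes a
  shift by one period.\<close>

lemma complementary_arc:
  fixes c :: complex and r s t :: real
  assumes r: "r > 0" and st: "s \<noteq> t" "\<bar>t - s\<bar> < 2 * pi"
  defines "arcim \<equiv> path_image (part_circlepath c r s t)"
    and "compim \<equiv> path_image (part_circlepath c r t (s + sgn (t - s) * (2 * pi)))"
  shows "sphere c r \<subseteq> arcim \<union> compim"
    and "arcim \<inter> compim \<subseteq> {pathstart (part_circlepath c r s t), pathfinish (part_circlepath c r s t)}"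
proof -
  define lo hi where "lo = min s t" and "hi = max s t"
  have lh: "lo < hi" "hi < lo + 2 * pi" using st by (auto simp: lo_def hi_def)
  have arc: "arcim = (\<lambda>x. c + r * cis x) ` {lo..hi}"
    unfolding arcim_def path_image_part_circlepath' closed_segment_eq_real_ivl lo_def hi_def
    by (auto simp: min_def max_def)
  have comp: "compim = (\<lambda>x. c + r * cis x) ` {hi..lo + 2 * pi}"
  proof (cases "s < t")
    case True
    then show ?thesis
      using lh unfolding compim_def path_image_part_circlepath' closed_segment_eq_real_ivl lo_def hi_def by auto
  next
    case False
    then have ts: "t < s" using st by simp
    have "compim = (\<lambda>x. c + r * cis x) ` {s - 2 * pi..t}"
      using ts lh unfolding compim_def path_image_part_circlepath' closed_segment_eq_real_ivl lo_def hi_def by auto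
    also have "\<dots> = (\<lambda>x. c + r * cis x) ` ((\<lambda>x. x + 2 * pi) ` {s - 2 * pi..t})"
      by (simp only: image_image cis_shift)
    also have "(\<lambda>x. x + 2 * pi) ` {s - 2 * pi..t} = {s..t + 2 * pi}" by simp
    finally show ?thesis using ts by (simp add: lo_def hi_def)
  qed
  show "sphere c r \<subseteq> arcim \<union> compim"
  proof
    fix q assume "q \<in> sphere c r"
    then obtain \<theta> where "lo \<le> \<theta>" "\<theta> < lo + 2 * pi" "q = c + r * cis \<theta>"
      using sphere_angle_above by metis
    then show "q \<in> arcim \<union> compim" unfolding arc comp by (cases "\<theta> \<le> hi") auto
  qed
  show "arcim \<inter> compim \<subseteq> {pathstart (part_circlepath c r s t), pathfinish (part_circlepath c r s t)}"
  proof
    fix q assume "q \<in> arcim \<inter> compim"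
    then have "q \<in> arcim" "q \<in> compim" by auto
    from \<open>q \<in> arcim\<close> obtain x where x: "lo \<le> x" "x \<le> hi" "q = c + r * cis x"
      unfolding arc by force
    from \<open>q \<in> compim\<close> obtain y where y: "hi \<le> y" "y \<le> lo + 2 * pi" "q = c + r * cis y"
      unfolding comp by force
    have "cis x = cis y" using x y r by auto
    then have "cis (y - x) = 1" by (simp add: cis_divide[symmetric])
    then have "cos (y - x) = 1" by (metis cis.sel(1) one_complex.sel(1))
    then obtain k :: int where k: "y - x = of_int k * 2 * pi" unfolding cos_one_2pi_int by auto
    \<comment> \<open>The angles differ by a multiple of 2 pi, which must be 0 or 2 pi: either both
      are \<open>hi\<close>, or \<open>x = lo\<close> and \<open>y = lo + 2 * pi\<close>.\<close>
    have "0 \<le> y - x" "y - x \<le> 2 * pi" using x y by auto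
    then have "0 \<le> k" "k \<le> 1" using pi_gt_zero unfolding k by (auto simp: zero_le_mult_iff)
    then have "k = 0 \<or> k = 1" by linarith
    then have "x = hi \<or> x = lo" using k x(1,2) y(1,2) by auto
    then have "x = s \<or> x = t" by (auto simp: lo_def hi_def min_def max_def split: if_splits)
    then show "q \<in> {pathstart (part_circlepath c r s t), pathfinish (part_circlepath c r s t)}"
      using x(3) by (auto simp: cis_conv_exp)
  qed
qed

text \<open>
  Together with the complementary arc the side forms a full circle, whose winding number is known,
  and the remaining terms \<open>f - winding_number comp\<close> are continuous at \<open>p\<close> and integer-valued off the
  circle, hence equal on both sides of the arc.
\<close>

lemma arc_side_local:
  fixes \<epsilon> :: real
  assumes simple: "simple_path \<gamma>" "pathfinish \<gamma> = pathstart \<gamma>"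
    and r: "r > 0" and st: "s \<noteq> t" "\<bar>t - s\<bar> < 2 * pi"
    and p: "p \<in> relative_interior_of_side (Arc c r s t)"
    and Q: "closed Q" "p \<notin> Q" and im: "path_image \<gamma> = path_image (part_circlepath c r s t) \<union> Q"
    and f: "continuous (at p) f"
    and wn: "\<And>w. w \<notin> path_image \<gamma> \<Longrightarrow> winding_number \<gamma> w = winding_number (part_circlepath c r s t) w + f w"
    and \<epsilon>: "\<epsilon> = 1 \<or> \<epsilon> = -1" "\<And>w. w \<in> inside (path_image \<gamma>) \<Longrightarrow> winding_number \<gamma> w = of_real \<epsilon>"
  shows "\<exists>e>0. inside (path_image \<gamma>) \<inter> ball p e \<subseteq> (if \<epsilon> = sgn (t - s) then ball c r else - cball c r)"
proof -
  define \<sigma> where "\<sigma> = sgn (t - s)"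
  have \<sigma>: "\<sigma> = 1 \<or> \<sigma> = -1" using st by (auto simp: \<sigma>_def sgn_if)
  let ?comp = "part_circlepath c r t (s + \<sigma> * (2 * pi))"
  note ca = complementary_arc[OF r st, of c, folded \<sigma>_def]
  have pa: "p \<in> path_image (part_circlepath c r s t)" and pc: "p \<notin> path_image ?comp"
    using p ca(2) by (auto simp: relative_interior_of_side_def)
  have ps: "p \<in> sphere c r" using pa path_image_part_circlepath_subset'[of r c s t] r by auto
  define K where "K w = Re (f w - winding_number ?comp w)" for w
  have "continuous (at p) K" unfolding K_def
    by (intro isCont_Re continuous_diff f continuous_at_winding_number[OF path_part_circlepath pc])
  \<comment> \<open>Tolerance 1/2 at \<open>p\<close> keeps any two values of \<open>K\<close> on
    the ball less than 1 apart, which forces integer values to agree.\<close>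
  then obtain e1 where e1: "e1 > 0" "\<And>w. dist w p < e1 \<Longrightarrow> dist (K w) (K p) < 1/2"
    unfolding continuous_at_eps_delta by (metis half_gt_zero zero_less_one)
  have "open (- (Q \<union> path_image ?comp))"
    using Q(1) closed_path_image[OF path_part_circlepath] by (intro open_Compl closed_Un) auto
  then obtain e2 where e2: "e2 > 0" "ball p e2 \<subseteq> - (Q \<union> path_image ?comp)"
    using Q(2) pc by (meson ComplI UnE open_contains_ball)
  define e where "e = min e1 e2"
  have e: "e > 0" using e1 e2 by (simp add: e_def)
  have Kd: "\<bar>K w - K v\<bar> < 1" if "w \<in> ball p e" "v \<in> ball p e" for w v
  proof -
    have "\<bar>K w - K p\<bar> < 1/2" "\<bar>K v - K p\<bar> < 1/2"
      using e1(2)[of w] e1(2)[of v] that by (auto simp: e_def dist_real_def dist_commute)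
    then show ?thesis by linarith
  qed
  have off: "w \<notin> Q" "w \<notin> path_image ?comp" if "w \<in> ball p e" for w
    using that e2(2) by (auto simp: e_def)
  have notin: "w \<notin> path_image \<gamma>" if "w \<in> ball p e" "w \<notin> sphere c r" for w
    using off[OF that(1)] that(2) path_image_part_circlepath_subset'[of r c s t] r im by auto
  have wnK: "Re (winding_number \<gamma> w) = K w + \<sigma> * indicator (ball c r) w" if "w \<in> ball p e" "w \<notin> sphere c r" for w
    using wn[OF notin[OF that]] winding_number_complementary_arcs[OF r \<sigma> that(2), of s t]
    by (auto simp: K_def complex_eq_iff)
  have onarc: "w \<notin> inside (path_image \<gamma>)" if "w \<in> ball p e" "w \<in> sphere c r" for w
  proof -
    have "w \<in> path_image (part_circlepath c r s t)" using ca(1) off[OF that(1)] that(2) by auto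
    then have "w \<in> path_image \<gamma>" using im by auto
    then show ?thesis by (simp add: inside_def)
  qed
  have val: "Re (winding_number \<gamma> w) = \<epsilon> \<and> w \<in> inside (path_image \<gamma>) \<or> Re (winding_number \<gamma> w) = 0"
    if "w \<in> ball p e" "w \<notin> sphere c r" for w
  proof (cases "w \<in> inside (path_image \<gamma>)")
    case False
    then have "w \<in> outside (path_image \<gamma>)"
      using notin[OF that] inside_Un_outside[of "path_image \<gamma>"] by blast
    then show ?thesis
      using winding_number_zero_in_outside[OF simple_path_imp_path[OF simple(1)] simple(2)] by simp
  qed (use \<epsilon> in auto)
  have frontier: "p \<in> frontier (ball c r)" "p \<in> frontier (cball c r)" using ps r by auto
  \<comment> \<open>As \<open>p\<close> lies on the circle, every ball around it has points on both
    sides; \<open>w1\<close> and \<open>w2\<close> serve for comparison.\<close>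
  obtain w1 where w1: "w1 \<in> ball p e" "w1 \<in> ball c r"
    using frontier(1) e unfolding frontier_straddle by (metis mem_ball)
  obtain w2 where w2: "w2 \<in> ball p e" "w2 \<notin> cball c r"
    using frontier(2) e unfolding frontier_straddle by (metis mem_ball)
  have K1: "K w1 = Re (winding_number \<gamma> w1) - \<sigma>" using wnK[OF w1(1)] w1(2) by auto
  have K2: "K w2 = Re (winding_number \<gamma> w2)" using wnK[OF w2(1)] w2(2) by auto
  have v1: "Re (winding_number \<gamma> w1) = \<epsilon> \<or> Re (winding_number \<gamma> w1) = 0" using val[OF w1(1)] w1(2) by auto
  have v2: "Re (winding_number \<gamma> w2) = \<epsilon> \<or> Re (winding_number \<gamma> w2) = 0" using val[OF w2(1)] w2(2) by auto
  have K12: "\<bar>K w1 - K w2\<bar> < 1" using Kd w1 w2 by blast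
  show ?thesis
  proof (rule exI[of _ e], intro conjI subsetI)
    show "e > 0" by (rule e)
    fix w assume w: "w \<in> inside (path_image \<gamma>) \<inter> ball p e"
    then have ws: "w \<notin> sphere c r" using onarc by auto
    have Kw: "\<epsilon> = K w + \<sigma> * indicator (ball c r) w" using wnK[of w] w ws \<epsilon>(2) by auto
    have d: "\<bar>K w - K w1\<bar> < 1" "\<bar>K w - K w2\<bar> < 1" using Kd w w1 w2 by auto
    \<comment> \<open>Inside the circle \<open>K w\<close> is \<epsilon> - \<sigma>, and comparison
      with \<open>w2\<close> puts this into {0, \<epsilon>}; for two signs this means \<epsilon> =
      \<sigma>. Outside it, \<open>K w\<close> is \<epsilon>, and comparison with \<open>w1\<close>
      puts \<epsilon> + \<sigma> into {0, \<epsilon>}, so \<epsilon> = -\<sigma>.\<close>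
    show "w \<in> (if \<epsilon> = sgn (t - s) then ball c r else - cball c r)"
    proof (cases "w \<in> ball c r")
      case True
      then have "\<epsilon> = \<sigma>" using Kw K1 K2 v1 v2 K12 d \<epsilon>(1) \<sigma> by auto
      then show ?thesis using True by (simp add: \<sigma>_def)
    next
      case False
      then have "\<epsilon> \<noteq> \<sigma>" using Kw K1 K2 v1 v2 K12 d \<epsilon>(1) \<sigma> by auto
      then show ?thesis using False ws by (simp add: \<sigma>_def)
    qed
  qed
qed

text \<open>Both properties would hold vacuously if \<open>I\<close> stayed away from the arc. Since
  the arc lies on the frontier of \<open>I\<close>, there are points of \<open>I\<close> arbitrarily
  near an interior point of the arc, and the two properties exclude each other.\<close>

lemma inward_outward_arc:
  assumes st: "s \<noteq> t" and r: "r > 0" and small: "\<bar>t - s\<bar> < 2 * pi"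
    and front: "path_image (part_circlepath c r s t) \<subseteq> frontier I"
    and local: "\<And>p. p \<in> relative_interior_of_side (Arc c r s t) \<Longrightarrow>
      \<exists>e>0. I \<inter> ball p e \<subseteq> (if b then ball c r else - cball c r)"
  shows "inward I (Arc c r s t) \<longleftrightarrow> \<not> b" and "outward I (Arc c r s t) \<longleftrightarrow> b"
proof -
  \<comment> \<open>The midpoint of the arc: its angle differs from those of the ends by less than
    pi and not by 0, so it is no end point.\<close>
  define p where "p = c + r * cis ((s + t) / 2)"
  have p: "p \<in> relative_interior_of_side (Arc c r s t)"
  proof -
    have ne: "cis ((s + t) / 2) \<noteq> cis u" if "u = s \<or> u = t" for u
    proof
      assume "cis ((s + t) / 2) = cis u"
      then have "cis ((s + t) / 2 - u) = 1" by (simp add: cis_divide[symmetric])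
      then have "cos ((s + t) / 2 - u) = 1" by (metis cis.sel(1) one_complex.sel(1))
      then obtain k :: int where k: "(s + t) / 2 - u = of_int k * 2 * pi" unfolding cos_one_2pi_int by auto
      have "\<bar>(s + t) / 2 - u\<bar> < pi" "(s + t) / 2 - u \<noteq> 0"
        using that small st by (auto simp: abs_if field_simps split: if_splits)
      then have "\<bar>of_int k :: real\<bar> * 2 * pi < 1 * pi" "k \<noteq> 0" unfolding k by (auto simp: abs_mult)
      then have "\<bar>of_int k :: real\<bar> * 2 < 1" using pi_gt_zero mult_less_cancel_right_pos by blast
      then show False using \<open>k \<noteq> 0\<close> by linarith
    qed
    have "(s + t) / 2 \<in> closed_segment s t"
      by (auto simp: closed_segment_eq_real_ivl)
    then have "p \<in> path_image (part_circlepath c r s t)"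
      unfolding path_image_part_circlepath' p_def by blast
    then show ?thesis
      using ne[of s] ne[of t] r by (auto simp: relative_interior_of_side_def p_def cis_conv_exp[symmetric])
  qed
  have pf: "p \<in> frontier I" using p front by (auto simp: relative_interior_of_side_def)
  have no: False if ee: "e > 0" "e' > 0" "I \<inter> ball p e \<subseteq> ball c r" "I \<inter> ball p e' \<subseteq> - cball c r" for e e'
  proof -
    obtain x where "x \<in> I" "dist p x < min e e'"
      using pf ee(1,2) unfolding frontier_straddle by (metis min_less_iff_conj)
    then have "x \<in> ball c r" "x \<in> - cball c r" using ee(3,4) by auto
    then show False by auto
  qed
  have "\<not> (inward I (Arc c r s t) \<and> outward I (Arc c r s t))"
  proof
    assume "inward I (Arc c r s t) \<and> outward I (Arc c r s t)"
    then obtain e e' where "e > 0" "e' > 0" "I \<inter> ball p e \<subseteq> ball c r" "I \<inter> ball p e' \<subseteq> - cball c r"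
      using p by (metis inward.simps(2) outward.simps(2))
    then show False by (rule no)
  qed
  moreover have "b \<Longrightarrow> outward I (Arc c r s t)" "\<not> b \<Longrightarrow> inward I (Arc c r s t)"
    using local by simp_all
  ultimately show "inward I (Arc c r s t) \<longleftrightarrow> \<not> b" "outward I (Arc c r s t) \<longleftrightarrow> b" by blast+
qed

section \<open>Sides of a polygon\<close>

fun side_velocity :: "side \<Rightarrow> real \<Rightarrow> complex" where
  "side_velocity (Segment a b) = (\<lambda>_. b - a)"
| "side_velocity (Arc c r s t) = (\<lambda>x. \<i> * r * (of_real t - of_real s) * exp (\<i> * of_real (linepath s t x)))"

text \<open>The signed angle through which the tangent turns; \<open>angle_measure\<close> is its
  absolute value.\<close>

fun side_turn :: "side \<Rightarrow> real" where
  "side_turn (Segment a b) = 0"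
| "side_turn (Arc c r s t) = t - s"

lemma valid_path_side: "valid_path (side_path S)"
  by (cases S) auto

lemma continuous_side_path: "continuous_on UNIV (side_path S)"
proof (cases S)
  case (Segment a b)
  then show ?thesis by (simp add: linepath_def continuous_intros)
qed (simp add: continuous_part_circlepath)

lemma continuous_side_velocity: "continuous_on UNIV (side_velocity S)"
  by (cases S) (simp_all add: continuous_part_circlepath(2))

lemma side_path_has_vector_derivative: "(side_path S has_vector_derivative side_velocity S t) (at t)"
proof (cases S)
  case (Segment a b)
  then show ?thesis by (simp add: has_vector_derivative_linepath_within)
qed (simp add: has_vector_derivative_part_circlepath)

text \<open>\<open>winding_integral\<close> is identified with the winding number only off the side;
  area integrals do not see the exception.\<close>

lemma path_image_side_null_sets:
  assumes "geodesic_side S"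
  shows "path_image (side_path S) \<in> null_sets lborel"
proof -
  have "negligible (path_image (side_path S))"
  proof (cases S)
    case (Segment a b)
    have "negligible (closed_segment a b)"
      by (simp add: negligible_convex_interior convex_closed_segment interior_closed_segment_ge2)
    then show ?thesis using Segment by simp
  next
    case (Arc c r s t)
    then have "r > 0" using assms by (simp add: orthogonal_to_unit_circle_def)
    then have "path_image (side_path S) \<subseteq> sphere c r"
      using Arc path_image_part_circlepath_subset'[of r c s t] by simp
    then show ?thesis by (rule negligible_subset[OF negligible_sphere])
  qed
  moreover have "path_image (side_path S) \<in> sets lborel"
    using closed_path_image[OF valid_path_imp_path[OF valid_path_side]] by auto
  ultimately show ?thesis by (simp add: negligible_iff_null_sets null_sets_completion_iff)
qed

lemma side_density_integral:
  assumes "R < 1" "geodesic_side S" "path_image (side_path S) \<subseteq> ball 0 R"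
  shows "Re (LINT w|lborel. truncated_density R w *\<^sub>R winding_integral (side_path S) (side_velocity S) w) = - side_turn S"
proof (cases S)
  case (Segment a b)
  then show ?thesis using assms diameter_density_integral[of R a b] by simp
next
  case (Arc c r s t)
  then show ?thesis
    using assms arc_density_integral[of R c r s t] by (simp add: norm_centre_orthogonal_circle)
qed

theorem mainTheorem2:
  fixes n l m :: nat and z :: "nat \<Rightarrow> complex" and S :: "nat \<Rightarrow> side"
  assumes "n \<ge> 3"
    and "hyperbolic_ngon n z S"
    and "l = card {k. k < n \<and> inward (ngon_region n S) (S k)}"
    and "m = card {k. k < n \<and> outward (ngon_region n S) (S k)}"
  shows "l + m = n \<and>
    hyperbolic_area (ngon_region n S) =
      (\<Sum>k | k < n \<and> inward (ngon_region n S) (S k). angle_measure (S k)) -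
      (\<Sum>k | k < n \<and> outward (ngon_region n S) (S k). angle_measure (S k))"
proof -
  define p where "p = (\<lambda>k. side_path (S k))"
  define N where "N = n - 1"
  define \<gamma> where "\<gamma> = join_upto p N"
  define I where "I = inside (path_image \<gamma>)"
  have nN: "n = Suc N" using assms(1) by (simp add: N_def)
  have \<gamma>: "boundary_curve n S = \<gamma>" 
    unfolding boundary_curve_def \<gamma>_def N_def p_def ..
  have I: "ngon_region n S = I" by (simp add: ngon_region_def \<gamma> I_def)
  have geo: "geodesic_side (S k)" and st: "pathstart (p k) = z k" "pathfinish (p k) = z (Suc k mod n)" if "k < n" for k
    using assms(2) that by (auto simp: hyperbolic_ngon_def geodesic_from_to_def p_def)
  have simple: "simple_path \<gamma>" and loop: "pathfinish \<gamma> = pathstart \<gamma>"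
    using assms(2) by (auto simp: hyperbolic_ngon_def jordan_curve_def \<gamma>)
  have con: "pathfinish (p k) = pathstart (p (Suc k))" if "k < N" for k
    using st[of k] st[of "Suc k"] that nN by simp
  have last: "pathfinish (p N) = pathstart (p 0)" using st[of N] st[of 0] nN by simp
  have paths: "path (p k)" for k unfolding p_def by (rule valid_path_imp_path[OF valid_path_side])
  have im: "path_image \<gamma> = (\<Union>k\<le>N. path_image (p k))"
    unfolding \<gamma>_def by (rule path_image_join_upto) (rule con)
  have wn: "winding_number \<gamma> w = (\<Sum>k\<le>N. winding_number (p k) w)" if "w \<notin> path_image \<gamma>" for w
    unfolding \<gamma>_def using that con paths im by (intro winding_number_join_upto) auto
  have sub: "path_image (p k) \<subseteq> ball 0 1" if "k < n" for k
    using geo[OF that] by (cases "S k") (auto simp: p_def)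
  have "path_image \<gamma> \<subseteq> ball 0 1" unfolding im using sub nN by (auto simp: less_Suc_eq_le)
  moreover have comp: "compact (path_image \<gamma>)" using simple by (simp add: compact_simple_path_image)
  ultimately obtain R where R: "R < 1" "path_image \<gamma> \<subseteq> ball 0 R"
  proof -
    assume sub1: "path_image \<gamma> \<subseteq> ball 0 1"
    assume that: "\<And>R. R < 1 \<Longrightarrow> path_image \<gamma> \<subseteq> ball 0 R \<Longrightarrow> thesis"
    have "path_image \<gamma> \<noteq> {}" by simp
    then obtain x where x: "x \<in> path_image \<gamma>" "\<And>y. y \<in> path_image \<gamma> \<Longrightarrow> norm y \<le> norm x"
      using continuous_attains_sup[OF comp, of norm] by (auto intro: continuous_intros)
    have "norm x < 1" using x(1) sub1 by auto
    then obtain R where "norm x < R" "R < 1" using dense by blast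
    then show thesis using x(2) by (intro that[of R]) force+
  qed
  \<comment> \<open>The complement of a convex set that contains the curve lies in the outside of
    the curve.\<close>
  have IR: "I \<subseteq> ball 0 R"
    using outside_subset_convex[OF convex_ball R(2)] inside_Int_outside[of "path_image \<gamma>"]
    unfolding I_def by blast
  have openI: "open I" and frontI: "frontier I = path_image \<gamma>"
    using Jordan_inside_outside[OF simple loop] by (auto simp: I_def)
  obtain \<epsilon> :: real where \<epsilon>: "\<epsilon> = 1 \<or> \<epsilon> = -1" "\<And>w. w \<in> I \<Longrightarrow> winding_number \<gamma> w = of_real \<epsilon>"
    using simple_closed_path_winding_number_inside[OF simple] unfolding I_def
    by (metis of_real_1 of_real_minus)
  have outer: "winding_number \<gamma> w = 0" if "w \<notin> I" "w \<notin> path_image \<gamma>" for w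
  proof -
    have "w \<in> outside (path_image \<gamma>)"
      using that inside_Un_outside[of "path_image \<gamma>"] unfolding I_def by blast
    then show ?thesis
      using winding_number_zero_in_outside[OF simple_path_imp_path[OF simple] loop] by simp
  qed

  have side: "(inward I (S k) \<longleftrightarrow> \<not> outward I (S k)) \<and>
      - \<epsilon> * side_turn (S k) = (if outward I (S k) then - angle_measure (S k) else angle_measure (S k))"
    if k: "k < n" for k
  proof (cases "S k")
    case (Segment a b)
    then show ?thesis by simp
  next
    case (Arc c r s t)
    have pk: "p k = part_circlepath c r s t" by (simp add: p_def Arc)
    have kN: "k \<le> N" using k nN by simp
    have r: "r > 0" and ne: "s \<noteq> t" and small: "\<bar>t - s\<bar> < 2 * pi"
      using geo[OF k] geodesic_arc_angle_less[of c r s t] by (auto simp: Arc orthogonal_to_unit_circle_def)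
    \<comment> \<open>The other sides avoid the interior points of side \<open>k\<close>, so their
      joint contribution \<open>f\<close> to the winding number is continuous there.\<close>
    define Q where "Q = (\<Union>j\<in>{..N} - {k}. path_image (p j))"
    define f where "f w = (\<Sum>j\<in>{..N} - {k}. winding_number (p j) w)" for w
    define b where "b \<longleftrightarrow> \<epsilon> = sgn (t - s)"
    have imQ: "path_image \<gamma> = path_image (part_circlepath c r s t) \<union> Q"
      unfolding im Q_def pk[symmetric] using kN by auto
    have loc: "\<exists>e>0. I \<inter> ball q e \<subseteq> (if b then ball c r else - cball c r)"
      if q: "q \<in> relative_interior_of_side (Arc c r s t)" for q
      unfolding b_def I_def
    proof (rule arc_side_local[OF simple loop r ne small q _ _ imQ _ _ \<epsilon>(1)])
      show "closed Q" unfolding Q_def using paths by (intro closed_UN) (auto intro: closed_path_image)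
      have nin: "q \<notin> path_image (p j)" if "j \<le> N" "j \<noteq> k" for j
        using simple_loop_join_upto_disjoint[OF con simple[unfolded \<gamma>_def] last kN that(1) that(2)[symmetric]] q
        by (auto simp: relative_interior_of_side_def pk)
      then show "q \<notin> Q" by (auto simp: Q_def)
      show "isCont f q" unfolding f_def
        using nin by (intro continuous_sum continuous_at_winding_number paths) auto
      show "winding_number \<gamma> w = winding_number (part_circlepath c r s t) w + f w" if "w \<notin> path_image \<gamma>" for w
        unfolding wn[OF that] f_def pk[symmetric] using kN by (subst sum.remove[of _ k]) auto
      show "winding_number \<gamma> w = of_real \<epsilon>" if "w \<in> inside (path_image \<gamma>)" for w
        using \<epsilon>(2) that by (simp add: I_def)
    qed
    have "path_image (part_circlepath c r s t) \<subseteq> frontier I" unfolding frontI imQ by auto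
    note io = inward_outward_arc[OF ne r small this loc]
    have "inward I (S k) \<longleftrightarrow> \<not> outward I (S k)" "outward I (S k) \<longleftrightarrow> b"
      unfolding Arc using io by blast+
    \<comment> \<open>The same comparison of signs \<open>b\<close> decides the kind of the side and
      the sign of its contribution.\<close>
    moreover have "- \<epsilon> * (t - s) = (if b then - \<bar>t - s\<bar> else \<bar>t - s\<bar>)"
      using \<epsilon>(1) ne by (auto simp: b_def sgn_if split: if_splits)
    ultimately show ?thesis unfolding Arc side_turn.simps angle_measure.simps by metis
  qed

  \<comment> \<open>Each side is of exactly one kind, so the two index sets are
    complementary.\<close>
  have parts: "{k. k < n \<and> inward I (S k)} = {..<n} - {k. k < n \<and> outward I (S k)}"
    using side by auto
  have osub: "{k. k < n \<and> outward I (S k)} \<subseteq> {..<n}" by auto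
  have "l + m = n"
    unfolding assms(3,4) I parts using card_Diff_subset[OF finite_subset[OF osub finite_lessThan] osub] card_mono[OF _ osub] by simp
  moreover have "hyperbolic_area I = (\<Sum>k<n. - \<epsilon> * side_turn (S k))"
  proof -
    let ?\<kappa> = "truncated_density R"
    let ?W = "\<lambda>k. winding_integral (p k) (side_velocity (S k))"
    have int: "integrable lborel (\<lambda>w. ?\<kappa> w *\<^sub>R ?W k w)" for k
      unfolding p_def
      by (rule integral_truncated_winding_integral(1)[OF R(1) continuous_side_path continuous_side_velocity])
    have W: "?W k w = winding_number (p k) w" if "w \<notin> path_image (p k)" for k w
      using that unfolding p_def
      by (intro winding_integral_eq valid_path_side side_path_has_vector_derivative continuous_on_subset[OF continuous_side_velocity]) auto
    have null: "path_image \<gamma> \<in> null_sets lborel"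
      unfolding im using path_image_side_null_sets geo nN by (intro null_sets.finite_UN) (auto simp: p_def less_Suc_eq_le)
    have "hyperbolic_area I = (LINT w|lborel. indicator I w *\<^sub>R (2 / (1 - (Re w)\<^sup>2 - (Im w)\<^sup>2))\<^sup>2)"
      by (simp add: hyperbolic_area_def set_lebesgue_integral_def)
    \<comment> \<open>Off the curve \<epsilon> times the winding number is the indicator of
      \<open>I\<close>, because \<epsilon> squares to 1; on \<open>I\<close> the cut-off at
      \<open>R\<close> changes nothing.\<close>
    also have "\<dots> = (LINT w|lborel. \<epsilon> * Re (\<Sum>k<n. ?\<kappa> w *\<^sub>R ?W k w))"
    proof (rule integral_cong_AE)
      show "(\<lambda>w. indicator I w *\<^sub>R (2 / (1 - (Re w)\<^sup>2 - (Im w)\<^sup>2))\<^sup>2) \<in> borel_measurable lborel"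
        using openI by (intro borel_measurable_scaleR borel_measurable_indicator) auto
      show "(\<lambda>w. \<epsilon> * Re (\<Sum>k<n. ?\<kappa> w *\<^sub>R ?W k w)) \<in> borel_measurable lborel"
        by (intro borel_measurable_integrable integrable_mult_right integrable_Re Bochner_Integration.integrable_sum int)
      show "AE w in lborel. indicator I w *\<^sub>R (2 / (1 - (Re w)\<^sup>2 - (Im w)\<^sup>2))\<^sup>2 = \<epsilon> * Re (\<Sum>k<n. ?\<kappa> w *\<^sub>R ?W k w)"
      proof (rule AE_I'[OF null], rule subsetI, rule ccontr)
        fix w assume w: "w \<in> {w \<in> space lborel. indicator I w *\<^sub>R (2 / (1 - (Re w)\<^sup>2 - (Im w)\<^sup>2))\<^sup>2 \<noteq> \<epsilon> * Re (\<Sum>k<n. ?\<kappa> w *\<^sub>R ?W k w)}"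
          and off: "w \<notin> path_image \<gamma>"
        have "(\<Sum>k<n. ?W k w) = winding_number \<gamma> w"
          unfolding wn[OF off] nN lessThan_Suc_atMost using off W im by (intro sum.cong) auto
        then have S: "(\<Sum>k<n. ?\<kappa> w *\<^sub>R ?W k w) = ?\<kappa> w *\<^sub>R winding_number \<gamma> w"
          by (simp flip: scaleR_sum_right)
        have "indicator I w *\<^sub>R (2 / (1 - (Re w)\<^sup>2 - (Im w)\<^sup>2))\<^sup>2 = \<epsilon> * Re (?\<kappa> w *\<^sub>R winding_number \<gamma> w)"
        proof (cases "w \<in> I")
          case True
          then have "w \<in> ball 0 R" using IR by auto
          then have "?\<kappa> w = (2 / (1 - (Re w)\<^sup>2 - (Im w)\<^sup>2))\<^sup>2"
            by (simp add: truncated_density_def cmod_power2 diff_diff_eq)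
          then show ?thesis using True \<epsilon> by auto
        next
          case False
          then show ?thesis using outer[OF False off] by simp
        qed
        then show False using w unfolding S[symmetric] by blast
      qed
    qed
    also have "\<dots> = \<epsilon> * (LINT w|lborel. Re (\<Sum>k<n. ?\<kappa> w *\<^sub>R ?W k w))"
      by (rule integral_mult_right_zero)
    also have "\<dots> = \<epsilon> * Re (LINT w|lborel. (\<Sum>k<n. ?\<kappa> w *\<^sub>R ?W k w))"
      using int by (subst integral_Re) auto
    also have "(LINT w|lborel. (\<Sum>k<n. ?\<kappa> w *\<^sub>R ?W k w)) = (\<Sum>k<n. LINT w|lborel. ?\<kappa> w *\<^sub>R ?W k w)"
      using int by (intro Bochner_Integration.integral_sum) auto
    also have "Re \<dots> = (\<Sum>k<n. - side_turn (S k))"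
      unfolding Re_sum p_def using R im nN
      by (intro sum.cong refl side_density_integral geo) (auto simp: p_def less_Suc_eq_le)
    finally show ?thesis by (simp add: sum_distrib_left)
  qed
  moreover have "(\<Sum>k<n. - \<epsilon> * side_turn (S k)) =
      (\<Sum>k | k < n \<and> inward I (S k). angle_measure (S k)) - (\<Sum>k | k < n \<and> outward I (S k). angle_measure (S k))"
  proof -
    have "(\<Sum>k<n. - \<epsilon> * side_turn (S k)) = (\<Sum>k<n. if outward I (S k) then - angle_measure (S k) else angle_measure (S k))"
      using side by (intro sum.cong) auto
    also have "\<dots> = (\<Sum>k | k < n \<and> outward I (S k). - angle_measure (S k)) + (\<Sum>k\<in>{..<n} - {k. k < n \<and> outward I (S k)}. angle_measure (S k))"
      by (subst sum.If_cases) (auto intro!: arg_cong2[where f = "(+)"] sum.cong)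
    finally show ?thesis unfolding parts by (simp add: sum_negf)
  qed
  ultimately show ?thesis unfolding I by simp
qed

end
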